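(* For a positive integer $r$ let $M^*(r)$ denote the maximum cardinality of an equiangular set of rank $r$. Then $$M^*(8)=14,\qquad M^*(9)=18,\qquad M^*(10)=18.$$
   Context: Equiangular set: a finite set $X=\{x_1,\dots,x_s\}$ of unit vectors in a Euclidean space is equiangular (with angle $\alpha$) if for some $\alpha\in[0,1)$ one has $\langle x_i,x_j\rangle\in\{-\alpha,\alpha\}$ for all $i\neq j$. Its rank is the dimension of the linear span of $X$ (equivalently, the rank of its Gram matrix). In $M^*(r)$ the maximum is over all angles $\alpha$ and all equiangular sets whose span has dimension exactly $r$. *)

theory Defs
  imports "HOL-Analysis.Analysis"
begin

text \<open>
  Finiteness is a hypothesis, as for sets written \<open>{x\<^sub>1, \<dots>, x\<^sub>s}\<close>. The rank is \<open>dim X\<close>, the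
  dimension of the linear span.
\<close>

definition equiangular :: "'a::euclidean_space set \<Rightarrow> bool" where
  "equiangular X \<longleftrightarrow> finite X \<and> (\<forall>x\<in>X. norm x = 1) \<and>
     (\<exists>\<alpha>. 0 \<le> \<alpha> \<and> \<alpha> < 1 \<and> (\<forall>x\<in>X. \<forall>y\<in>X. x \<noteq> y \<longrightarrow> x \<bullet> y \<in> {-\<alpha>, \<alpha>}))"

text \<open>
  A type variable cannot be quantified inside a definition, so the ambient space is a parameter.
  It is only a place to realise the configurations: the cardinalities that occur for rank \<open>r\<close> are
  the same in all Euclidean spaces of dimension at least \<open>r\<close> (\<open>equiangular_cards_ambient\<close> below),
  and those of smaller dimension contain no set of rank \<open>r\<close> (\<open>equiangular_cards_eq_empty\<close>).
\<close>

definition equiangular_cards :: "'a::euclidean_space itself \<Rightarrow> nat \<Rightarrow> nat set" where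
  "equiangular_cards _ r = {card X | X :: 'a set. equiangular X \<and> dim X = r}"

definition M_star :: "'a::euclidean_space itself \<Rightarrow> nat \<Rightarrow> nat" where
  "M_star TYPE('a) r = Max (equiangular_cards TYPE('a) r)"

lemma equiangular_cards_eq_empty:
  "DIM('a::euclidean_space) < r \<Longrightarrow> equiangular_cards TYPE('a) r = {}"
  unfolding equiangular_cards_def using dim_subset_UNIV[where 'a='a] by (auto simp: not_le[symmetric])

lemma equiangular_cards_ambient_subset:
  assumes "r \<le> DIM('b::euclidean_space)"
  shows "equiangular_cards TYPE('a::euclidean_space) r \<subseteq> equiangular_cards TYPE('b) r"
proof
  fix k assume "k \<in> equiangular_cards TYPE('a) r"
  then obtain X :: "'a set" where X: "equiangular X" "dim X = r" "k = card X"
    unfolding equiangular_cards_def by auto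
  obtain T :: "'b set" where T: "subspace T" "dim T = r"
    using choose_subspace_of_subspace[of r "UNIV :: 'b set"] assms by auto
  have "dim (span X) = dim T" using X T by simp
  from isometries_subspaces[OF subspace_span T(1) this]
  obtain f g where f: "linear f" "f ` span X = T" "\<And>x. x \<in> span X \<Longrightarrow> norm (f x) = norm x"
    "\<And>x. x \<in> span X \<Longrightarrow> g (f x) = x"
    by metis
  have inn: "f x \<bullet> f y = x \<bullet> y" if "x \<in> X" "y \<in> X" for x y
  proof -
    have s: "x \<in> span X" "y \<in> span X" "x + y \<in> span X"
      using that by (auto intro: span_base span_add)
    then have "norm (f x + f y) = norm (x + y)"
      using f(3)[OF s(3)] linear_add[OF f(1)] by simp
    then show ?thesis using f(3)[OF s(1)] f(3)[OF s(2)] by (simp add: dot_norm)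
  qed
  have inj: "inj_on f (span X)" using f(4) by (rule inj_on_inverseI)
  then have injX: "inj_on f X" by (rule inj_on_subset) (rule span_superset)
  have "equiangular (f ` X)"
    using X(1) unfolding equiangular_def
    by (auto simp: inn f(3) span_base) metis+
  moreover have "dim (f ` X) = r"
    using dim_image_eq[OF f(1) inj] X(2) by simp
  moreover have "card (f ` X) = k" using card_image[OF injX] X(3) by simp
  ultimately show "k \<in> equiangular_cards TYPE('b) r"
    unfolding equiangular_cards_def by blast
qed

lemma equiangular_cards_ambient:
  assumes "r \<le> DIM('a::euclidean_space)" "r \<le> DIM('b::euclidean_space)"
  shows "equiangular_cards TYPE('a) r = equiangular_cards TYPE('b) r"
  using equiangular_cards_ambient_subset[where 'a='a and 'b='b, OF assms(2)]
    equiangular_cards_ambient_subset[where 'a='b and 'b='a, OF assms(1)] by (rule subset_antisym)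

lemma equiangular_cards_nonempty:
  assumes "r \<le> DIM('a::euclidean_space)"
  shows "equiangular_cards TYPE('a) r \<noteq> {}"
proof -
  obtain X :: "'a set" where X: "X \<subseteq> Basis" "card X = r" "finite X"
    using obtain_subset_with_card_n[OF assms] by blast
  have "independent X" using independent_mono[OF independent_Basis X(1)] .
  then have "dim X = r" using X by (simp add: dim_eq_card_independent)
  moreover have "equiangular X"
    unfolding equiangular_def using X
    by (auto simp: subset_iff inner_not_same_Basis intro!: exI[of _ 0])
  ultimately show ?thesis unfolding equiangular_cards_def by blast
qed

text \<open>
  A crude form of Gerzon's bound; it makes \<open>Max\<close> in \<open>M_star\<close> a genuine maximum.
\<close>

lemma equiangular_card_le:
  fixes X :: "'a::euclidean_space set"
  assumes "equiangular X"
  shows "card X \<le> DIM('a) * DIM('a)"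
proof -
  obtain \<alpha> where fin: "finite X" and un: "\<And>x. x \<in> X \<Longrightarrow> norm x = 1"
    and \<alpha>: "0 \<le> \<alpha>" "\<alpha> < 1"
    and ip: "\<And>x y. x \<in> X \<Longrightarrow> y \<in> X \<Longrightarrow> x \<noteq> y \<Longrightarrow> x \<bullet> y \<in> {-\<alpha>, \<alpha>}"
    using assms unfolding equiangular_def by blast
  define E :: "'a \<Rightarrow> 'a \<Rightarrow> 'a \<Rightarrow>\<^sub>L 'a" where "E u v = Blinfun (\<lambda>y. (u \<bullet> y) *\<^sub>R v)" for u v
  have E: "blinfun_apply (E u v) y = (u \<bullet> y) *\<^sub>R v" for u v y
    unfolding E_def by (subst bounded_linear_Blinfun_apply) (auto intro!: bounded_linear_intros)
  define T where "T = (\<lambda>(b, c). E b c) ` (Basis \<times> Basis)"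
  define F where "F x = E x x - (\<alpha>\<^sup>2) *\<^sub>R id_blinfun" for x
  have Tin: "E b c \<in> span T" if "b \<in> Basis" "c \<in> Basis" for b c
    using that unfolding T_def by (auto intro!: span_base)
  have e1: "E u v = (\<Sum>b\<in>Basis. \<Sum>c\<in>Basis. ((u \<bullet> b) * (v \<bullet> c)) *\<^sub>R E b c)" for u v
  proof (rule blinfun_eqI)
    fix y
    have "blinfun_apply (\<Sum>b\<in>Basis. \<Sum>c\<in>Basis. ((u \<bullet> b) * (v \<bullet> c)) *\<^sub>R E b c) y
      = (\<Sum>b\<in>Basis. \<Sum>c\<in>Basis. ((u \<bullet> b) * (b \<bullet> y)) *\<^sub>R ((v \<bullet> c) *\<^sub>R c))"
      by (simp add: blinfun.sum_left blinfun.scaleR_left E mult_ac)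
    also have "\<dots> = (\<Sum>b\<in>Basis. ((u \<bullet> b) * (b \<bullet> y)) *\<^sub>R v)"
      by (simp only: scaleR_sum_right[symmetric] euclidean_representation)
    also have "\<dots> = (u \<bullet> y) *\<^sub>R v"
      by (subst euclidean_inner[of u y]) (simp add: scaleR_sum_left inner_commute)
    finally show "blinfun_apply (E u v) y = blinfun_apply (\<Sum>b\<in>Basis. \<Sum>c\<in>Basis. ((u \<bullet> b) * (v \<bullet> c)) *\<^sub>R E b c) y"
      by (simp add: E)
  qed
  have e2: "id_blinfun = (\<Sum>b\<in>Basis. E b (b::'a))"
    by (rule blinfun_eqI) (simp add: blinfun.sum_left E inner_commute[of _ "_::'a"] euclidean_representation)
  have "E u v \<in> span T" for u v
    by (subst e1) (intro span_sum span_scale Tin)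
  moreover have "id_blinfun \<in> span T"
    unfolding e2 by (intro span_sum Tin)
  ultimately have FT: "F ` X \<subseteq> span T" unfolding F_def by (auto intro!: span_diff span_scale)
  have Fv: "blinfun_apply (F x) y \<bullet> y = (if x = y then 1 - \<alpha>\<^sup>2 else 0)" if "x \<in> X" "y \<in> X" for x y
  proof -
    have "y \<bullet> y = 1" using un[OF that(2)] by (simp add: dot_square_norm)
    then have "blinfun_apply (F x) y \<bullet> y = (x \<bullet> y)\<^sup>2 - \<alpha>\<^sup>2"
      by (simp add: F_def blinfun.diff_left blinfun.scaleR_left E inner_diff_left power2_eq_square)
    then show ?thesis using ip[OF that] \<open>y \<bullet> y = 1\<close> by auto
  qed
  have ne: "1 - \<alpha>\<^sup>2 \<noteq> 0" using \<alpha> by (simp add: power2_eq_1_iff)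
  have inj: "inj_on F X"
  proof (rule inj_onI, rule ccontr)
    fix x y assume "x \<in> X" "y \<in> X" "F x = F y" "x \<noteq> y"
    then show False using Fv[of x y] Fv[of y y] ne by simp
  qed
  have "independent (F ` X)"
  proof (rule independent_if_scalars_zero)
    show "finite (F ` X)" using fin by simp
    fix u z assume s: "(\<Sum>z\<in>F ` X. u z *\<^sub>R z) = 0" and "z \<in> F ` X"
    then obtain y where y: "y \<in> X" "z = F y" by auto
    have "0 = blinfun_apply (\<Sum>x\<in>X. u (F x) *\<^sub>R F x) y \<bullet> y"
      using s by (simp add: sum.reindex[OF inj] o_def)
    also have "\<dots> = (\<Sum>x\<in>X. u (F x) * (blinfun_apply (F x) y \<bullet> y))"
      by (simp add: blinfun.sum_left blinfun.scaleR_left inner_sum_left)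
    also have "\<dots> = (\<Sum>x\<in>X. if x = y then u (F x) * (1 - \<alpha>\<^sup>2) else 0)"
      by (rule sum.cong) (auto simp: Fv y)
    also have "\<dots> = u (F y) * (1 - \<alpha>\<^sup>2)" using fin y by simp
    finally show "u z = 0" using ne y by simp
  qed
  then have "card (F ` X) \<le> card T"
    using independent_span_bound[OF _ _ FT] unfolding T_def by auto
  also have "card T \<le> card ((Basis :: 'a set) \<times> (Basis :: 'a set))"
    unfolding T_def by (intro card_image_le) auto
  finally show ?thesis using card_image[OF inj] by (simp add: card_cartesian_product)
qed

lemma finite_equiangular_cards: "finite (equiangular_cards TYPE('a::euclidean_space) r)"
  by (rule finite_subset[of _ "{..DIM('a) * DIM('a)}"])
     (auto simp: equiangular_cards_def dest: equiangular_card_le)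

end

theory Submission
  imports Defs "Jordan_Normal_Form.Schur_Decomposition" "HOL-Library.Z2"
begin

text \<open>
  Let \<open>X\<close> be an equiangular set of rank \<open>r\<close> with angle \<open>\<alpha> > 0\<close> and \<open>n\<close> vectors, and put
  \<open>a = 1/\<alpha>\<close>. The Gram matrix is \<open>I + S/a\<close>, where the Seidel matrix \<open>S\<close> is integral and symmetric,
  has zero diagonal and has entries \<open>1\<close> and \<open>-1\<close> elsewhere. Since the Gram matrix has rank \<open>r\<close>, the
  number \<open>-a\<close> is an eigenvalue of \<open>S\<close> of multiplicity \<open>m = n - r\<close>. The upper bounds suppose that
  \<open>n\<close> is one more than the claimed maximum, so that \<open>(r, n, m)\<close> is \<open>(8, 15, 7)\<close>, \<open>(9, 19, 10)\<close> or
  \<open>(10, 19, 9)\<close>, and determine \<open>a\<close>.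

  \<^item> The minimal polynomial of \<open>-a\<close> over the rationals divides the characteristic polynomial of \<open>S\<close>
    to the power \<open>m\<close> (\<open>multiple_root_of_monic_int_poly\<close>). Since \<open>n < 3m\<close>, its degree is at most
    \<open>2\<close>, so \<open>a\<close> is an integer or a quadratic irrationality; the latter needs \<open>2m \<le> n\<close>.

  \<^item> If \<open>-a\<close> is quadratic, then \<open>n = 2m + 1\<close>, and \<open>S\<close> has the two conjugates with multiplicity \<open>m\<close>
    each and one further eigenvalue \<open>\<lambda>\<close>. The minimal polynomial evaluated at \<open>S\<close> is a multiple of
    the projection to the eigenvector of \<open>\<lambda>\<close> and has constant diagonal, so this eigenvector has
    entries \<open>1\<close> and \<open>-1\<close> after scaling. Changing the signs of some vectors of \<open>X\<close> turns it into the
    all-one vector, and then parity of the row sums is contradictory, because \<open>m\<close> is odd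
    (\<open>no_seidel_matrix_with_conjugate_eigenvalues\<close>).

  \<^item> If \<open>a\<close> is an integer, it is at most \<open>4\<close> by the relative bound (\<open>card_power2_le_dim_sum_inner\<close>).
    It is odd, since for even \<open>a\<close> every principal submatrix of \<open>aI + S\<close> of even order is congruent
    to \<open>J - I\<close> modulo \<open>2\<close>, where \<open>J\<close> is the all-one matrix, and therefore is nonsingular
    (\<open>det_ne_0_even_diag_odd_off_diag\<close>),
    while those of order larger than \<open>r\<close> are singular. As \<open>\<alpha> < 1\<close>, this leaves \<open>a = 3\<close>.

  For angle \<open>1/3\<close> the set is linearly independent, or up to signs it contains three vectors with
  mutual inner products \<open>-1/3\<close>. In the second case the classical pillar decomposition of Lemmens and
  Seidel applies: modulo the span of this triple, the other vectors fall into three pillars of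
  vectors such that two vectors of one pillar are orthogonal or opposite and two vectors of different
  pillars have angle 60 or 120 degrees. Two nonempty pillars generate a space of dimension at most
  \<open>4\<close>, which keeps the rank at most \<open>7\<close>. So from rank \<open>8\<close> on there is one pillar, and
  \<open>n \<le> 4 + 2 (r - 3) = 2 (r - 1)\<close> (\<open>equiangular_third_card_le\<close>). This is \<open>14\<close>, \<open>16\<close> and \<open>18\<close> for
  the ranks in question, less than \<open>n\<close> in each case.

  A full pillar attains \<open>2 (r - 1)\<close> and settles ranks \<open>8\<close> and \<open>10\<close>. In rank \<open>9\<close> the Paley conference
  matrix of order \<open>18\<close> has eigenvalues \<open>\<surd>17\<close> and \<open>-\<surd>17\<close> of multiplicity \<open>9\<close> each and yields \<open>18\<close>
  vectors with angle \<open>1/\<surd>17\<close>.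
\<close>

text \<open>
  Below, \<open>det\<close> and \<open>mat\<close> belong to matrices of explicit size, while orthogonality and the
  bullet belong to Euclidean spaces.
\<close>

hide_const (open) Matrix.orthogonal Determinants.det Finite_Cartesian_Product.mat
hide_fact (open) Matrix.orthogonal_def
no_notation Matrix.scalar_prod (infix "\<bullet>" 70)

section \<open>The relative bound\<close>

text \<open>
  The frame operator \<open>\<Sum>x\<in>X. x x\<^sup>T\<close> lives on a space of dimension \<open>dim X\<close> and has trace \<open>card X\<close>.
  The double sum is its squared Frobenius norm, to which the Cauchy--Schwarz inequality applies.
\<close>

lemma card_power2_le_dim_sum_inner:
  fixes X :: "'a::euclidean_space set"
  assumes fin: "finite X" and un: "\<And>x. x \<in> X \<Longrightarrow> norm x = 1"
  shows "(real (card X))\<^sup>2 \<le> real (dim X) * (\<Sum>x\<in>X. \<Sum>y\<in>X. (x \<bullet> y)\<^sup>2)"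
proof -
  obtain B where B: "B \<subseteq> span X" "pairwise orthogonal B" "\<And>b. b \<in> B \<Longrightarrow> norm b = 1"
    "independent B" "card B = dim (span X)" "span B = span X"
    using orthonormal_basis_subspace[OF subspace_span[of X]] by metis
  have fB: "finite B" using B(4) by (rule independent_imp_finite)
  have cB: "card B = dim X" using B(5) by simp
  have expand: "x \<bullet> y = (\<Sum>b\<in>B. (x \<bullet> b) * (y \<bullet> b))" if "x \<in> X" for x y
  proof -
    have "x \<in> span B" using that B(6) by (simp add: span_base)
    then have "(\<Sum>b\<in>B. (x \<bullet> b) *\<^sub>R b) = x"
      using B(2,3) fB by (intro orthonormal_basis_expand) auto
    then have "x \<bullet> y = (\<Sum>b\<in>B. (x \<bullet> b) *\<^sub>R b) \<bullet> y" by simp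
    then show ?thesis by (simp add: inner_sum_left inner_commute[of y])
  qed
  \<comment> \<open>the matrix of the frame operator in the orthonormal basis\<close>
  define A where "A b c = (\<Sum>x\<in>X. (x \<bullet> b) * (x \<bullet> c))" for b c
  have tr: "(\<Sum>b\<in>B. A b b) = real (card X)"
  proof -
    have "(\<Sum>b\<in>B. A b b) = (\<Sum>x\<in>X. \<Sum>b\<in>B. (x \<bullet> b) * (x \<bullet> b))"
      unfolding A_def by (rule sum.swap)
    also have "\<dots> = (\<Sum>x\<in>X. x \<bullet> x)" by (intro sum.cong refl expand[symmetric])
    also have "\<dots> = (\<Sum>x\<in>X. 1)" using un by (intro sum.cong) (auto simp: dot_square_norm)
    finally show ?thesis by simp
  qed
  have "(\<Sum>x\<in>X. \<Sum>y\<in>X. (x \<bullet> y)\<^sup>2) = (\<Sum>x\<in>X. \<Sum>y\<in>X. \<Sum>b\<in>B. \<Sum>c\<in>B. ((x \<bullet> b) * (x \<bullet> c)) * ((y \<bullet> b) * (y \<bullet> c)))"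
  proof (intro sum.cong refl)
    fix x y assume "x \<in> X"
    then have "(x \<bullet> y)\<^sup>2 = (\<Sum>b\<in>B. (x \<bullet> b) * (y \<bullet> b))\<^sup>2" by (simp only: expand[of x y])
    then show "(x \<bullet> y)\<^sup>2 = (\<Sum>b\<in>B. \<Sum>c\<in>B. ((x \<bullet> b) * (x \<bullet> c)) * ((y \<bullet> b) * (y \<bullet> c)))"
      by (simp add: power2_eq_square sum_product mult_ac)
  qed
  also have "\<dots> = (\<Sum>x\<in>X. \<Sum>b\<in>B. \<Sum>y\<in>X. \<Sum>c\<in>B. ((x \<bullet> b) * (x \<bullet> c)) * ((y \<bullet> b) * (y \<bullet> c)))"
    by (intro sum.cong refl sum.swap)
  also have "\<dots> = (\<Sum>b\<in>B. \<Sum>x\<in>X. \<Sum>y\<in>X. \<Sum>c\<in>B. ((x \<bullet> b) * (x \<bullet> c)) * ((y \<bullet> b) * (y \<bullet> c)))"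
    by (rule sum.swap)
  also have "\<dots> = (\<Sum>b\<in>B. \<Sum>x\<in>X. \<Sum>c\<in>B. \<Sum>y\<in>X. ((x \<bullet> b) * (x \<bullet> c)) * ((y \<bullet> b) * (y \<bullet> c)))"
    by (intro sum.cong refl sum.swap)
  also have "\<dots> = (\<Sum>b\<in>B. \<Sum>c\<in>B. \<Sum>x\<in>X. \<Sum>y\<in>X. ((x \<bullet> b) * (x \<bullet> c)) * ((y \<bullet> b) * (y \<bullet> c)))"
    by (intro sum.cong refl sum.swap)
  also have "\<dots> = (\<Sum>b\<in>B. \<Sum>c\<in>B. (A b c)\<^sup>2)"
    unfolding A_def power2_eq_square sum_product ..
  finally have fro: "(\<Sum>x\<in>X. \<Sum>y\<in>X. (x \<bullet> y)\<^sup>2) = (\<Sum>b\<in>B. \<Sum>c\<in>B. (A b c)\<^sup>2)" .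
  have "(real (card X))\<^sup>2 = (\<Sum>b\<in>B. 1 * A b b)\<^sup>2" using tr by simp
  also have "\<dots> \<le> (\<Sum>b\<in>B. 1\<^sup>2) * (\<Sum>b\<in>B. (A b b)\<^sup>2)" by (rule Cauchy_Schwarz_ineq_sum)
  also have "\<dots> = real (dim X) * (\<Sum>b\<in>B. (A b b)\<^sup>2)" using cB by simp
  also have "\<dots> \<le> real (dim X) * (\<Sum>b\<in>B. \<Sum>c\<in>B. (A b c)\<^sup>2)"
    using fB by (intro mult_left_mono sum_mono member_le_sum) auto
  finally show ?thesis using fro by simp
qed

section \<open>Sets with angle 1/3\<close>

text \<open>
  The vectors that a pillar leaves after projection have squared norm \<open>2/3\<close>, and any two of them are
  orthogonal or opposite. A basis cannot contain opposite vectors.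
\<close>

lemma orthogonal_basis_of_roots:
  fixes R :: "'a::euclidean_space set"
  assumes nm: "\<And>v. v \<in> R \<Longrightarrow> v \<bullet> v = 2/3"
    and ip: "\<And>v w. v \<in> R \<Longrightarrow> w \<in> R \<Longrightarrow> v \<noteq> w \<Longrightarrow> v \<bullet> w \<in> {0, -2/3}"
  obtains B where "B \<subseteq> R" "finite B" "card B = dim R" "R \<subseteq> span B"
    "\<And>v w. v \<in> B \<Longrightarrow> w \<in> B \<Longrightarrow> v \<noteq> w \<Longrightarrow> v \<bullet> w = 0"
proof -
  obtain B where B: "B \<subseteq> R" "independent B" "R \<subseteq> span B" "card B = dim R"
    using basis_exists by blast
  have "v \<bullet> w = 0" if vw: "v \<in> B" "w \<in> B" "v \<noteq> w" for v w
  proof (rule ccontr)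
    assume "v \<bullet> w \<noteq> 0"
    then have "v \<bullet> w = -2/3" using ip[of v w] vw B(1) by auto
    then have "(v + w) \<bullet> (v + w) = 0"
      using nm[of v] nm[of w] vw B(1) by (simp add: inner_simps inner_commute[of w v] subset_iff)
    then have "v = - w" by (simp add: eq_neg_iff_add_eq_0)
    moreover have "w \<in> span (B - {v})" using vw by (intro span_base) auto
    ultimately have "v \<in> span (B - {v})" by (metis span_neg)
    then show False using B(2) vw(1) by (auto simp: dependent_def)
  qed
  then show ?thesis using that[of B] B independent_imp_finite by blast
qed

lemma card_orthogonal_or_opposite_le:
  fixes R :: "'a::euclidean_space set"
  assumes nm: "\<And>v. v \<in> R \<Longrightarrow> v \<bullet> v = 2/3"
    and ip: "\<And>v w. v \<in> R \<Longrightarrow> w \<in> R \<Longrightarrow> v \<noteq> w \<Longrightarrow> v \<bullet> w \<in> {0, -2/3}"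
  shows "card R \<le> 2 * dim R"
proof -
  obtain B where B: "B \<subseteq> R" "finite B" "card B = dim R" "R \<subseteq> span B"
    by (rule orthogonal_basis_of_roots[of R]) (use nm ip in auto)
  have "R \<subseteq> B \<union> uminus ` B"
  proof
    fix v assume v: "v \<in> R"
    show "v \<in> B \<union> uminus ` B"
    proof (rule ccontr)
      assume nin: "v \<notin> B \<union> uminus ` B"
      have "orthogonal v b" if "b \<in> B" for b
      proof (rule ccontr)
        assume "\<not> orthogonal v b"
        then have "v \<bullet> b = -2/3" using ip[of v b] v that B(1) nin by (auto simp: orthogonal_def)
        then have "(v + b) \<bullet> (v + b) = 0"
          using nm[of v] nm[of b] v that B(1) by (simp add: inner_simps inner_commute[of b v] subset_iff)
        then have "v = - b" by (simp add: eq_neg_iff_add_eq_0)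
        then show False using nin that by auto
      qed
      then have "orthogonal v v" using B(4) v by (intro orthogonal_to_span[of v B]) auto
      then show False using nm[OF v] by (simp add: orthogonal_def)
    qed
  qed
  then have "card R \<le> card (B \<union> uminus ` B)" using B(2) by (intro card_mono) auto
  also have "\<dots> \<le> card B + card (uminus ` B)" by (rule card_Un_le)
  also have "\<dots> \<le> 2 * dim R" using card_image_le[OF B(2), of uminus] B(3) by simp
  finally show ?thesis .
qed

text \<open>
  The equality case of the Cauchy--Schwarz inequality.
\<close>

lemma parallel_if_extremal_inner:
  fixes g g' :: "'a::real_inner"
  assumes "g \<bullet> g = s" "g' \<bullet> g' = s" "\<bar>g \<bullet> g'\<bar> \<ge> s"
  shows "g' \<in> span {g}"
proof (cases "g \<bullet> g' \<ge> 0")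
  case True
  then have "(g' - g) \<bullet> (g' - g) \<le> 0" using assms by (simp add: inner_simps inner_commute)
  then have "g' = g" by (metis inner_ge_zero inner_eq_zero_iff order_antisym eq_iff_diff_eq_0)
  then show ?thesis by (simp add: span_base)
next
  case False
  then have "(g' + g) \<bullet> (g' + g) \<le> 0" using assms by (simp add: inner_simps inner_commute)
  then have "g' = - g" by (metis inner_ge_zero inner_eq_zero_iff order_antisym eq_neg_iff_add_eq_0)
  then show ?thesis by (simp add: span_base span_neg)
qed

text \<open>
  Let \<open>B\<^sub>1\<close> be an orthogonal basis of the largest pillar. Each \<open>w\<close> from another pillar has inner
  products \<open>1/3\<close> or \<open>-1/3\<close> with all of \<open>B\<^sub>1\<close>, so its component \<open>g w\<close> orthogonal to \<open>B\<^sub>1\<close> has squared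
  norm \<open>2/3 - d/6\<close> with \<open>d = card B\<^sub>1\<close>. In particular \<open>d \<le> 4\<close>. The inner products of two such
  components are again confined to a few values, which forces the components to be parallel or
  orthogonal. They span at most \<open>4 - d\<close> dimensions when \<open>d \<ge> 2\<close>; for \<open>d \<le> 1\<close> each pillar has
  dimension at most \<open>1\<close>.
\<close>

lemma dim_three_pillars_le:
  fixes R1 R2 R3 :: "'a::euclidean_space set"
  assumes nm: "\<And>v. v \<in> R1 \<union> R2 \<union> R3 \<Longrightarrow> v \<bullet> v = 2/3"
    and ip1: "\<And>v w. v \<in> R1 \<Longrightarrow> w \<in> R1 \<Longrightarrow> v \<noteq> w \<Longrightarrow> v \<bullet> w \<in> {0, -2/3}"
    and ip2: "\<And>v w. v \<in> R2 \<Longrightarrow> w \<in> R2 \<Longrightarrow> v \<noteq> w \<Longrightarrow> v \<bullet> w \<in> {0, -2/3}"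
    and ip3: "\<And>v w. v \<in> R3 \<Longrightarrow> w \<in> R3 \<Longrightarrow> v \<noteq> w \<Longrightarrow> v \<bullet> w \<in> {0, -2/3}"
    and c12: "\<And>v w. v \<in> R1 \<Longrightarrow> w \<in> R2 \<Longrightarrow> v \<bullet> w \<in> {1/3, -1/3}"
    and c13: "\<And>v w. v \<in> R1 \<Longrightarrow> w \<in> R3 \<Longrightarrow> v \<bullet> w \<in> {1/3, -1/3}"
    and c23: "\<And>v w. v \<in> R2 \<Longrightarrow> w \<in> R3 \<Longrightarrow> v \<bullet> w \<in> {1/3, -1/3}"
    and max: "dim R2 \<le> dim R1" "dim R3 \<le> dim R1" and ne: "R2 \<union> R3 \<noteq> {}"
  shows "dim (R1 \<union> R2 \<union> R3) \<le> 4"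
proof -
  obtain B1 where B1: "B1 \<subseteq> R1" "finite B1" "card B1 = dim R1" "R1 \<subseteq> span B1"
    "\<And>v w. v \<in> B1 \<Longrightarrow> w \<in> B1 \<Longrightarrow> v \<noteq> w \<Longrightarrow> v \<bullet> w = 0"
    by (rule orthogonal_basis_of_roots[of R1]) (use nm ip1 in auto)
  obtain B2 where B2: "B2 \<subseteq> R2" "finite B2" "card B2 = dim R2" "R2 \<subseteq> span B2"
    "\<And>v w. v \<in> B2 \<Longrightarrow> w \<in> B2 \<Longrightarrow> v \<noteq> w \<Longrightarrow> v \<bullet> w = 0"
    by (rule orthogonal_basis_of_roots[of R2]) (use nm ip2 in auto)
  obtain B3 where B3: "B3 \<subseteq> R3" "finite B3" "card B3 = dim R3" "R3 \<subseteq> span B3"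
    "\<And>v w. v \<in> B3 \<Longrightarrow> w \<in> B3 \<Longrightarrow> v \<noteq> w \<Longrightarrow> v \<bullet> w = 0"
    by (rule orthogonal_basis_of_roots[of R3]) (use nm ip3 in auto)
  have nmB: "e \<bullet> e = 2/3" if "e \<in> B1 \<union> B2 \<union> B3" for e
    using that nm[of e] B1(1) B2(1) B3(1) by auto
  have cB1: "w \<bullet> e = 1/3 \<or> w \<bullet> e = -1/3" if "w \<in> B2 \<union> B3" "e \<in> B1" for w e
    using that c12[of e w] c13[of e w] B1(1) B2(1) B3(1) by (auto simp: inner_commute)
  have dimS: "dim (R1 \<union> R2 \<union> R3) \<le> card S" if "finite S" "B1 \<union> B2 \<union> B3 \<subseteq> span S" for S
  proof -
    have "span B1 \<subseteq> span S" "span B2 \<subseteq> span S" "span B3 \<subseteq> span S"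
      using that(2) by (intro span_minimal subspace_span; blast)+
    then have "R1 \<union> R2 \<union> R3 \<subseteq> span S" using B1(4) B2(4) B3(4) by auto
    then show ?thesis using that(1) by (rule dim_le_card)
  qed
  \<comment> \<open>\<open>3/2\<close> is the inverse of the squared norm of the basis vectors\<close>
  define g where "g w = w - (\<Sum>e\<in>B1. (3/2 * (w \<bullet> e)) *\<^sub>R e)" for w
  have gg: "g w \<bullet> g w' = w \<bullet> w' - 3/2 * (\<Sum>e\<in>B1. (w \<bullet> e) * (w' \<bullet> e))" for w w'
  proof -
    have k: "e \<bullet> (\<Sum>f\<in>B1. (3/2 * (w' \<bullet> f)) *\<^sub>R f) = w' \<bullet> e" if "e \<in> B1" for e
    proof -
      have "e \<bullet> (\<Sum>f\<in>B1. (3/2 * (w' \<bullet> f)) *\<^sub>R f) = (\<Sum>f\<in>B1. if f = e then w' \<bullet> e else 0)"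
        unfolding inner_sum_right
        by (intro sum.cong refl) (use that B1(5)[of e] nmB[of e] in auto)
      then show ?thesis using that B1(2) by simp
    qed
    have "(\<Sum>e\<in>B1. (3/2 * (w \<bullet> e)) *\<^sub>R e) \<bullet> (\<Sum>f\<in>B1. (3/2 * (w' \<bullet> f)) *\<^sub>R f)
       = 3/2 * (\<Sum>e\<in>B1. (w \<bullet> e) * (w' \<bullet> e))"
      unfolding inner_sum_left inner_scaleR_left sum_distrib_left
      by (intro sum.cong refl) (simp only: k mult.assoc)
    moreover have "w \<bullet> (\<Sum>f\<in>B1. (3/2 * (w' \<bullet> f)) *\<^sub>R f) = 3/2 * (\<Sum>e\<in>B1. (w \<bullet> e) * (w' \<bullet> e))"
      by (simp add: inner_sum_right sum_distrib_left mult_ac)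
    moreover have "(\<Sum>e\<in>B1. (3/2 * (w \<bullet> e)) *\<^sub>R e) \<bullet> w' = 3/2 * (\<Sum>e\<in>B1. (w \<bullet> e) * (w' \<bullet> e))"
      by (simp add: inner_sum_left sum_distrib_left mult_ac inner_commute[of w'])
    ultimately show ?thesis by (simp add: g_def inner_diff_left inner_diff_right)
  qed
  have ggself: "g w \<bullet> g w = 2/3 - real (card B1) / 6" if "w \<in> B2 \<union> B3" for w
  proof -
    have "(\<Sum>e\<in>B1. (w \<bullet> e) * (w \<bullet> e)) = (\<Sum>e\<in>B1. 1/9)"
    proof (intro sum.cong refl)
      fix e assume e: "e \<in> B1"
      show "(w \<bullet> e) * (w \<bullet> e) = 1/9" using cB1[OF that e] by (elim disjE; simp only:; simp)
    qed
    then show ?thesis using gg[of w w] nmB[of w] that by simp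
  qed
  have cross: "w \<bullet> w' = 1/3 \<or> w \<bullet> w' = -1/3"
    if "w \<in> B2 \<and> w' \<in> B3 \<or> w \<in> B3 \<and> w' \<in> B2" for w w'
    using that c23[of w w'] c23[of w' w] B2(1) B3(1) by (auto simp: inner_commute)
  have wg: "w \<in> span S" if "g w \<in> span S" "B1 \<subseteq> S" for w S
  proof -
    have "w = g w + (\<Sum>e\<in>B1. (3/2 * (w \<bullet> e)) *\<^sub>R e)" by (simp add: g_def)
    also have "\<dots> \<in> span S"
      using that by (intro span_add span_sum span_scale) (auto intro: span_base)
    finally show ?thesis .
  qed
  have B1S: "B1 \<subseteq> span S" if "B1 \<subseteq> S" for S :: "'a set"
    using that span_superset by blast
  have "B2 \<union> B3 \<noteq> {}"
  proof
    assume "B2 \<union> B3 = {}"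
    then have "R2 \<union> R3 \<subseteq> {0}" using B2(4) B3(4) by auto
    then obtain z where "z \<in> R2 \<union> R3" "z = 0" using ne by blast
    then show False using nm[of z] by auto
  qed
  then obtain w0 where w0: "w0 \<in> B2 \<union> B3" by blast
  have "card B1 \<le> 4" using ggself[OF w0] inner_ge_zero[of "g w0"] by simp
  then consider "card B1 = 4" | "card B1 = 3" | "card B1 = 2" | "card B1 \<le> 1" by linarith
  then show ?thesis
  proof cases
    case 1
    have "B2 \<union> B3 \<subseteq> span B1"
    proof
      fix w assume "w \<in> B2 \<union> B3"
      then have "g w = 0" using ggself[of w] 1 by simp
      then show "w \<in> span B1" using wg[of w B1] by (simp add: span_zero)
    qed
    then show ?thesis using dimS[OF B1(2)] B1S[of B1] 1 by auto
  next
    case 2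
    obtain a b c where abc: "B1 = {a, b, c}" "a \<noteq> b" "a \<noteq> c" "b \<noteq> c"
      using 2 by (auto simp: card_3_iff)
    have s: "(\<Sum>e\<in>B1. f e) = f a + f b + f c" for f :: "'a \<Rightarrow> real"
      using abc by simp
    have gp: "g w \<in> span {g w0}" if w: "w \<in> B2 \<union> B3" for w
    proof (cases "w = w0")
      case False
      have i: "w0 \<bullet> w = 0 \<or> w0 \<bullet> w = 1/3 \<or> w0 \<bullet> w = -1/3"
        using cross[of w0 w] B2(5)[of w0 w] B3(5)[of w0 w] False w w0 by auto
      have e: "a \<in> B1" "b \<in> B1" "c \<in> B1" using abc by auto
      have "\<bar>w0 \<bullet> w - 3/2 * ((w0 \<bullet> a) * (w \<bullet> a) + (w0 \<bullet> b) * (w \<bullet> b) + (w0 \<bullet> c) * (w \<bullet> c))\<bar> \<ge> 1/6"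
        using i cB1[OF w e(1)] cB1[OF w e(2)] cB1[OF w e(3)] cB1[OF w0 e(1)] cB1[OF w0 e(2)] cB1[OF w0 e(3)]
        by - (elim disjE; simp only:; simp)
      then have "\<bar>g w0 \<bullet> g w\<bar> \<ge> 1/6" unfolding gg s .
      then show ?thesis
        using ggself[OF w] ggself[OF w0] 2 by (intro parallel_if_extremal_inner[of _ "1/6"]) auto
    qed (simp add: span_base)
    have "B2 \<union> B3 \<subseteq> span (insert (g w0) B1)"
    proof
      fix w assume "w \<in> B2 \<union> B3"
      then have "g w \<in> span (insert (g w0) B1)"
        using gp span_mono[of "{g w0}" "insert (g w0) B1"] by auto
      then show "w \<in> span (insert (g w0) B1)" by (rule wg) auto
    qed
    then have "dim (R1 \<union> R2 \<union> R3) \<le> card (insert (g w0) B1)"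
      using B1(2) B1S[of "insert (g w0) B1"] by (intro dimS) auto
    also have "\<dots> \<le> 4" using 2 B1(2) card_insert_le_m1[of 4 B1 "g w0"] by simp
    finally show ?thesis .
  next
    case 3
    obtain a b where ab: "B1 = {a, b}" "a \<noteq> b"
      using 3 by (auto simp: card_2_iff)
    have s: "(\<Sum>e\<in>B1. f e) = f a + f b" for f :: "'a \<Rightarrow> real"
      using ab by simp
    have e: "a \<in> B1" "b \<in> B1" using ab by auto
    \<comment> \<open>The components \<open>g w\<close> turn out to be parallel within a class.\<close>
    define key where "key w \<longleftrightarrow> (w \<in> B2 \<longleftrightarrow> (w \<bullet> a) * (w \<bullet> b) > 0)" for w
    have gp: "g w' \<in> span {g w}" if w: "w \<in> B2 \<union> B3" "w' \<in> B2 \<union> B3" "key w = key w'" for w w'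
    proof (cases "w = w'")
      case False
      have "\<bar>w \<bullet> w' - 3/2 * ((w \<bullet> a) * (w' \<bullet> a) + (w \<bullet> b) * (w' \<bullet> b))\<bar> \<ge> 1/3"
      proof (cases "w \<in> B2 \<longleftrightarrow> w' \<in> B2")
        case True
        then have "w \<bullet> w' = 0" using w False B2(5)[of w w'] B3(5)[of w w'] by auto
        moreover have "(w \<bullet> a) * (w \<bullet> b) > 0 \<longleftrightarrow> (w' \<bullet> a) * (w' \<bullet> b) > 0"
          using w(3) True by (auto simp: key_def)
        ultimately show ?thesis
          using cB1[OF w(1) e(1)] cB1[OF w(1) e(2)] cB1[OF w(2) e(1)] cB1[OF w(2) e(2)]
          by - (elim disjE; simp only:; simp)
      next
        case False
        then have "w \<bullet> w' = 1/3 \<or> w \<bullet> w' = -1/3" using w cross[of w w'] by auto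
        moreover have "(w \<bullet> a) * (w \<bullet> b) > 0 \<longleftrightarrow> \<not> (w' \<bullet> a) * (w' \<bullet> b) > 0"
          using w(3) False by (auto simp: key_def)
        ultimately show ?thesis
          using cB1[OF w(1) e(1)] cB1[OF w(1) e(2)] cB1[OF w(2) e(1)] cB1[OF w(2) e(2)]
          by - (elim disjE; simp only:; simp)
      qed
      then have "\<bar>g w \<bullet> g w'\<bar> \<ge> 1/3" unfolding gg s .
      then show ?thesis
        using ggself[OF w(1)] ggself[OF w(2)] 3 by (intro parallel_if_extremal_inner[of _ "1/3"]) auto
    qed (simp add: span_base)
    have "\<exists>G. \<forall>w\<in>B2 \<union> B3. key w = k \<longrightarrow> g w \<in> span {G}" for k
    proof (cases "\<exists>w\<in>B2 \<union> B3. key w = k")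
      case True
      then obtain w where w: "w \<in> B2 \<union> B3" "key w = k" by blast
      show ?thesis by (rule exI[of _ "g w"]) (use gp[OF w(1)] w(2) in blast)
    qed blast
    then have "\<forall>k. \<exists>G. \<forall>w\<in>B2 \<union> B3. key w = k \<longrightarrow> g w \<in> span {G}" ..
    then obtain G where G': "\<forall>k. \<forall>w\<in>B2 \<union> B3. key w = k \<longrightarrow> g w \<in> span {G k}"
      unfolding choice_iff ..
    have G: "g w \<in> span {G k}" if "w \<in> B2 \<union> B3" "key w = k" for w k
      using G' that by blast
    let ?S = "B1 \<union> {G True, G False}"
    have "B2 \<union> B3 \<subseteq> span ?S"
    proof
      fix w assume "w \<in> B2 \<union> B3"
      then have "g w \<in> span {G (key w)}" using G by blast
      moreover have "{G (key w)} \<subseteq> ?S" by (cases "key w") auto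
      ultimately have "g w \<in> span ?S" using span_mono by blast
      then show "w \<in> span ?S" by (rule wg) auto
    qed
    then have "dim (R1 \<union> R2 \<union> R3) \<le> card ?S"
      using B1(2) B1S[of ?S] by (intro dimS) auto
    also have "\<dots> \<le> card B1 + card {G True, G False}" by (rule card_Un_le)
    also have "\<dots> \<le> 4" using 3 card_insert_le_m1[of 2 "{G False}" "G True"] by simp
    finally show ?thesis .
  next
    case 4
    have "dim (R1 \<union> R2 \<union> R3) \<le> card (B1 \<union> B2 \<union> B3)"
      using B1(2) B2(2) B3(2) by (intro dimS) (auto intro: span_base)
    also have "\<dots> \<le> card B1 + card B2 + card B3"
      using card_Un_le[of "B1 \<union> B2" B3] card_Un_le[of B1 B2] by linarith
    also have "\<dots> \<le> 4" using 4 B1(3) B2(3) B3(3) max by simp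
    finally show ?thesis .
  qed
qed

text \<open>
  The sign of a product over a triple is unaffected by replacing vectors with their negatives. If all
  these signs are positive, the negations that make one chosen vector have positive inner products
  with the others make all inner products equal to \<open>c\<close>, and the Gram matrix \<open>(1 - c) I + c J\<close> is
  nonsingular.
\<close>

lemma independent_if_all_triples_positive:
  fixes X :: "'a::euclidean_space set"
  assumes fin: "finite X" and un: "\<And>x. x \<in> X \<Longrightarrow> x \<bullet> x = 1" and c: "0 < c" "c < 1"
    and ip: "\<And>x y. x \<in> X \<Longrightarrow> y \<in> X \<Longrightarrow> x \<noteq> y \<Longrightarrow> x \<bullet> y \<in> {c, -c}"
    and pos: "\<And>x y z. x \<in> X \<Longrightarrow> y \<in> X \<Longrightarrow> z \<in> X \<Longrightarrow> x \<noteq> y \<Longrightarrow> y \<noteq> z \<Longrightarrow> x \<noteq> z \<Longrightarrow>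
      (x \<bullet> y) * (y \<bullet> z) * (z \<bullet> x) > 0"
  shows "independent X"
proof (cases "X = {}")
  case False
  then obtain o' where o: "o' \<in> X" by blast
  define \<sigma> where "\<sigma> x = sgn (o' \<bullet> x)" for x
  have \<sigma>: "\<sigma> x = 1 \<or> \<sigma> x = -1" if "x \<in> X" for x
    using ip[OF o that] un[OF that] c by (cases "x = o'") (auto simp: \<sigma>_def)
  have sw: "\<sigma> x * \<sigma> y * (x \<bullet> y) = c" if xy: "x \<in> X" "y \<in> X" "x \<noteq> y" for x y
  proof -
    have "\<sigma> x * \<sigma> y * (x \<bullet> y) > 0"
    proof (cases "x = o' \<or> y = o'")
      case True
      have k: "\<sigma> z * (o' \<bullet> z) > 0" if "z \<in> X" for z
        using \<sigma>[OF that] by (auto simp: \<sigma>_def sgn_if split: if_splits)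
      have "\<sigma> o' = 1" using un[OF o] by (simp add: \<sigma>_def)
      then show ?thesis using True k[OF xy(1)] k[OF xy(2)] by (auto simp: inner_commute[of x o'])
    next
      case False
      then have "(o' \<bullet> x) * (x \<bullet> y) * (y \<bullet> o') > 0" using pos[of o' x y] o xy by auto
      then have "sgn ((o' \<bullet> x) * (x \<bullet> y) * (y \<bullet> o')) = 1" by (simp only: sgn_pos)
      then have "\<sigma> x * sgn (x \<bullet> y) * \<sigma> y = 1"
        by (simp add: \<sigma>_def sgn_mult inner_commute[of y o'])
      then have "sgn (\<sigma> x * \<sigma> y * (x \<bullet> y)) = 1"
        using \<sigma>[OF xy(1)] \<sigma>[OF xy(2)] by (auto simp: sgn_mult)
      then show ?thesis by (simp add: sgn_1_pos)
    qed
    moreover have "x \<bullet> y = c \<or> x \<bullet> y = -c" using ip[OF xy] by auto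
    ultimately show ?thesis using \<sigma>[OF xy(1)] \<sigma>[OF xy(2)] c by auto
  qed
  show ?thesis
  proof (rule independent_if_scalars_zero[OF fin])
    fix f z assume s: "(\<Sum>x\<in>X. f x *\<^sub>R x) = 0" and z: "z \<in> X"
    define D where "D = (\<Sum>x\<in>X. \<sigma> x * f x)"
    have eq: "(1 - c) * (\<sigma> y * f y) + c * D = 0" if y: "y \<in> X" for y
    proof -
      have "0 = \<sigma> y * ((\<Sum>x\<in>X. f x *\<^sub>R x) \<bullet> y)" using s by simp
      also have "\<dots> = (\<Sum>x\<in>X. \<sigma> y * f x * (x \<bullet> y))"
        by (simp add: inner_sum_left sum_distrib_left mult.assoc)
      also have "\<dots> = (\<Sum>x\<in>X. c * (\<sigma> x * f x) + (if x = y then (1 - c) * (\<sigma> y * f y) else 0))"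
      proof (rule sum.cong[OF refl])
        fix x assume x: "x \<in> X"
        show "\<sigma> y * f x * (x \<bullet> y) = c * (\<sigma> x * f x) + (if x = y then (1 - c) * (\<sigma> y * f y) else 0)"
        proof (cases "x = y")
          case True then show ?thesis using un[OF y] by (simp add: algebra_simps)
        next
          case False
          have "\<sigma> x * \<sigma> x = 1" using \<sigma>[OF x] by auto
          then have "\<sigma> y * f x * (x \<bullet> y) = (\<sigma> x * \<sigma> x) * (\<sigma> y * f x * (x \<bullet> y))" by simp
          also have "\<dots> = \<sigma> x * f x * (\<sigma> x * \<sigma> y * (x \<bullet> y))" by (simp only: mult_ac)
          also have "\<dots> = \<sigma> x * f x * c" by (simp only: sw[OF x y False])
          finally show ?thesis using False by (simp add: mult_ac)
        qed
      qed
      also have "\<dots> = c * D + (1 - c) * (\<sigma> y * f y)"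
        using y fin by (simp add: sum.distrib D_def sum_distrib_left)
      finally show ?thesis by simp
    qed
    have "0 = (\<Sum>y\<in>X. (1 - c) * (\<sigma> y * f y) + c * D)" using eq by simp
    also have "\<dots> = (1 - c) * D + real (card X) * (c * D)"
      by (simp add: sum.distrib D_def sum_distrib_left)
    also have "\<dots> = ((1 - c) + real (card X) * c) * D" by (simp add: algebra_simps)
    finally have "((1 - c) + real (card X) * c) * D = 0" by simp
    moreover have "(1 - c) + real (card X) * c > 0" using c by (intro add_pos_nonneg) auto
    ultimately have "D = 0" by simp
    then show "f z = 0" using eq[OF z] \<sigma>[OF z] c by auto
  qed
qed (simp add: independent_empty)

lemma card_inter_opposite_pair_le:
  fixes X :: "'a::euclidean_space set"
  assumes "v \<noteq> 0 \<Longrightarrow> \<not> (v \<in> X \<and> - v \<in> X)"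
  shows "card (X \<inter> {v, - v}) \<le> 1"
proof -
  have "X \<inter> {v, -v} \<subseteq> {v} \<or> X \<inter> {v, -v} \<subseteq> {-v}" using assms by (cases "v = 0") auto
  then show ?thesis
    using card_mono[of "{v}" "X \<inter> {v, -v}"] card_mono[of "{-v}" "X \<inter> {v, -v}"] by fastforce
qed

text \<open>
  After negating some of \<open>a, b, c\<close> they have mutual inner products \<open>-1/3\<close>. Every other vector has
  inner products \<open>1/3\<close> or \<open>-1/3\<close> with the triple. If the three signs agree, it is plus or minus the
  sum of the triple; at most four vectors are accounted for by this and by the triple itself. The
  remaining vectors form three pillars according to which of the three signs differs.
\<close>

lemma card_le_if_negative_triple:
  fixes X :: "'a::euclidean_space set"
  assumes fin: "finite X" and un: "\<And>x. x \<in> X \<Longrightarrow> x \<bullet> x = 1"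
    and ip: "\<And>x y. x \<in> X \<Longrightarrow> y \<in> X \<Longrightarrow> x \<noteq> y \<Longrightarrow> x \<bullet> y \<in> {1/3, -1/3}"
    and abc: "a \<in> X" "b \<in> X" "c \<in> X" "a \<noteq> b" "b \<noteq> c" "a \<noteq> c"
    and neg: "(a \<bullet> b) * (b \<bullet> c) * (c \<bullet> a) < 0"
    and dim: "dim X \<ge> 8"
  shows "card X \<le> 2 * (dim X - 1)"
proof -
  define p2 where "p2 = (if a \<bullet> b > 0 then - b else b)"
  define p3 where "p3 = (if a \<bullet> c > 0 then - c else c)"
  have pp: "a \<bullet> a = 1" "p2 \<bullet> p2 = 1" "p3 \<bullet> p3 = 1"
    using un[of a] un[of b] un[of c] abc by (auto simp: p2_def p3_def)
  have abs3: "\<bar>a \<bullet> b\<bar> = 1/3" "\<bar>b \<bullet> c\<bar> = 1/3" "\<bar>a \<bullet> c\<bar> = 1/3"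
    using ip[of a b] ip[of b c] ip[of a c] abc by auto
  have "(a \<bullet> b) * (b \<bullet> c) * (a \<bullet> c) < 0" using neg by (simp only: inner_commute[of c a])
  have "p2 \<bullet> p3 = - \<bar>b \<bullet> c\<bar>"
  proof -
    have "u > 0 \<and> w > 0 \<and> v < 0 \<or> u > 0 \<and> \<not> w > 0 \<and> v > 0 \<or> \<not> u > 0 \<and> w > 0 \<and> v > 0 \<or> \<not> u > 0 \<and> \<not> w > 0 \<and> v < 0"
      if "u * v * w < 0" for u v w :: real
      using that by (simp only: mult_less_0_iff zero_less_mult_iff) linarith
    from this[OF \<open>(a \<bullet> b) * (b \<bullet> c) * (a \<bullet> c) < 0\<close>]
    show ?thesis by (elim disjE conjE) (simp_all add: p2_def p3_def)
  qed
  moreover have "a \<bullet> p2 = - \<bar>a \<bullet> b\<bar>" by (simp add: p2_def)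
  moreover have "a \<bullet> p3 = - \<bar>a \<bullet> c\<bar>" by (simp add: p3_def)
  ultimately have pq: "a \<bullet> p2 = -1/3" "a \<bullet> p3 = -1/3" "p2 \<bullet> p3 = -1/3"
    "p2 \<bullet> a = -1/3" "p3 \<bullet> a = -1/3" "p3 \<bullet> p2 = -1/3"
    using abs3 by (simp_all only: inner_commute[of p2 a] inner_commute[of p3 a] inner_commute[of p3 p2])
  have pm: "p2 = b \<or> p2 = - b" "p3 = c \<or> p3 = - c" by (simp_all add: p2_def p3_def)
  have psp: "a \<in> span X" "p2 \<in> span X" "p3 \<in> span X"
    using abc by (auto simp: p2_def p3_def span_base span_neg)
  \<comment> \<open>Vectors of pillar \<open>i\<close> project to \<open>h i\<close> or its negative in the span of the triple.\<close>
  define h where "h i = (if i = 0 then (1/2) *\<^sub>R (p2 + p3) else if i = 1 then (1/2) *\<^sub>R (a + p3)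
    else (1/2) *\<^sub>R (a + p2))" for i :: nat
  have h: "h 0 = (1/2) *\<^sub>R (p2 + p3)" "h 1 = (1/2) *\<^sub>R (a + p3)" "h (Suc 0) = (1/2) *\<^sub>R (a + p3)"
    "h 2 = (1/2) *\<^sub>R (a + p2)" by (simp_all add: h_def)
  have less3: "i < 3 \<longleftrightarrow> i = 0 \<or> i = 1 \<or> i = 2" for i :: nat by auto
  have hh: "h i \<bullet> h j = (if i = j then 1/3 else 0)" if "i < 3" "j < 3" for i j
    using that pp pq by (auto simp: less3 h inner_simps)
  have hsp: "h i \<in> span X" if "i < 3" for i
    using that psp by (auto simp: less3 h intro!: span_scale span_add)
  \<comment> \<open>the triple together with the negative of the fourth vertex of its tetrahedron\<close>
  define Q where "Q = {a, p2, p3, a + p2 + p3}"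
  define P where "P = {x \<in> X. x \<in> Q \<or> - x \<in> Q}"
  have nopp: "\<not> (v \<in> X \<and> - v \<in> X)" if "v \<noteq> 0" for v
  proof
    assume v: "v \<in> X \<and> - v \<in> X"
    have "v \<noteq> - v" using that by (metis eq_neg_iff_add_eq_0 scaleR_2 scaleR_eq_0_iff zero_neq_numeral)
    then show False using ip[of v "- v"] un[of v] v by auto
  qed
  have cP: "card P \<le> 4"
  proof -
    have "P \<subseteq> (\<Union>q\<in>Q. X \<inter> {q, - q})"
    proof
      fix x assume "x \<in> P"
      then have "x \<in> X" "x \<in> Q \<or> - x \<in> Q" unfolding P_def by blast+
      then obtain q where "q \<in> Q" "x = q \<or> x = - q" by (metis minus_minus)
      then show "x \<in> (\<Union>q\<in>Q. X \<inter> {q, - q})" using \<open>x \<in> X\<close> by blast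
    qed
    then have "card P \<le> card (\<Union>q\<in>Q. X \<inter> {q, - q})"
      by (intro card_mono) (auto simp: Q_def)
    also have "\<dots> \<le> (\<Sum>q\<in>Q. card (X \<inter> {q, - q}))" by (rule card_UN_le) (simp add: Q_def)
    also have "\<dots> \<le> (\<Sum>q\<in>Q. 1)"
      by (intro sum_mono card_inter_opposite_pair_le nopp)
    also have "\<dots> \<le> 4"
      using card_insert_le_m1[of 4 "{p2,p3,a+p2+p3}" a] card_insert_le_m1[of 3 "{p3,a+p2+p3}" p2]
        card_insert_le_m1[of 2 "{a+p2+p3}" p3] by (simp add: Q_def)
    finally show ?thesis .
  qed
  define Z where "Z i = {x \<in> X - P. x \<bullet> h i \<noteq> 0}" for i
  have pillar: "\<exists>i<3. \<bar>x \<bullet> h i\<bar> = 1/3 \<and> (\<forall>j<3. j \<noteq> i \<longrightarrow> x \<bullet> h j = 0)" if x: "x \<in> X - P" for x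
  proof -
    have nQ: "x \<notin> Q" "- x \<notin> Q" using x by (auto simp: P_def)
    have xp: "x \<bullet> p = 1/3 \<or> x \<bullet> p = -1/3" if "p \<in> {a, p2, p3}" for p
    proof -
      have "p = a \<or> p = p2 \<or> p = p3" using that by simp
      then have "p = a \<or> (p = b \<or> p = - b) \<or> (p = c \<or> p = - c)" using pm by (elim disjE) simp_all
      then obtain q where q: "q \<in> X" "p = q \<or> p = - q" using abc(1-3) by metis
      have "p \<in> Q" using that unfolding Q_def by blast
      then have "x \<noteq> q" using q nQ by blast
      then have "x \<bullet> q = 1/3 \<or> x \<bullet> q = -1/3" using ip[of x q] x q by blast
      with q(2) show ?thesis by (elim disjE) simp_all
    qed
    have ex: "x \<bullet> x = 1" using un x by blast
    have p4: "(a + p2 + p3) \<bullet> (a + p2 + p3) = 1" using pp pq by (simp add: inner_simps)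
    have "\<not> (x \<bullet> a = 1/3 \<and> x \<bullet> p2 = 1/3 \<and> x \<bullet> p3 = 1/3)"
    proof
      assume *: "x \<bullet> a = 1/3 \<and> x \<bullet> p2 = 1/3 \<and> x \<bullet> p3 = 1/3"
      then have 1: "x \<bullet> (a + p2 + p3) = 1" by (simp add: inner_simps)
      then have "(x - (a + p2 + p3)) \<bullet> (x - (a + p2 + p3)) = 0"
        using ex p4 inner_commute[of x "a + p2 + p3"] by (simp only: inner_diff_left inner_diff_right)
      then have "x = a + p2 + p3" by simp
      then show False using nQ by (simp add: Q_def)
    qed
    moreover have "\<not> (x \<bullet> a = -1/3 \<and> x \<bullet> p2 = -1/3 \<and> x \<bullet> p3 = -1/3)"
    proof
      assume *: "x \<bullet> a = -1/3 \<and> x \<bullet> p2 = -1/3 \<and> x \<bullet> p3 = -1/3"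
      then have 1: "x \<bullet> (a + p2 + p3) = -1" by (simp add: inner_simps)
      then have "(x + (a + p2 + p3)) \<bullet> (x + (a + p2 + p3)) = 0"
        using ex p4 inner_commute[of x "a + p2 + p3"] by (simp only: inner_add_left[of x "a+p2+p3"] inner_add_right[of _ x "a+p2+p3"])
      then have "x + (a + p2 + p3) = 0" by simp
      then have "- x = a + p2 + p3" by (rule minus_unique)
      then show False using nQ by (simp add: Q_def)
    qed
    moreover have xh: "x \<bullet> h 0 = (x \<bullet> p2 + x \<bullet> p3) / 2" "x \<bullet> h 1 = (x \<bullet> a + x \<bullet> p3) / 2"
      "x \<bullet> h 2 = (x \<bullet> a + x \<bullet> p2) / 2" by (simp_all add: h inner_simps)
    have ex3: "(\<exists>i<3. F i) \<longleftrightarrow> F 0 \<or> F 1 \<or> F 2" "(\<forall>i<3. F i) \<longleftrightarrow> F 0 \<and> F 1 \<and> F 2" for F :: "nat \<Rightarrow> bool"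
      by (auto simp: less3)
    ultimately show ?thesis
      unfolding ex3 xh using xp[of a, simplified] xp[of p2, simplified] xp[of p3, simplified]
      by (elim disjE; simp only:; simp)
  qed
  have Zval: "\<bar>x \<bullet> h i\<bar> = 1/3" "\<And>j. j < 3 \<Longrightarrow> j \<noteq> i \<Longrightarrow> x \<bullet> h j = 0" if x: "x \<in> Z i" "i < 3" for x i
  proof -
    obtain k where k: "k < 3" "\<bar>x \<bullet> h k\<bar> = 1/3" "\<forall>j<3. j \<noteq> k \<longrightarrow> x \<bullet> h j = 0"
      using pillar[of x] x by (auto simp: Z_def)
    then have "k = i" using x by (auto simp: Z_def)
    then show "\<bar>x \<bullet> h i\<bar> = 1/3" "\<And>j. j < 3 \<Longrightarrow> j \<noteq> i \<Longrightarrow> x \<bullet> h j = 0" using k by auto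
  qed
  \<comment> \<open>the component orthogonal to the triple, after the sign change that projects \<open>x\<close> to \<open>h i\<close>\<close>
  define \<rho> where "\<rho> i x = sgn (x \<bullet> h i) *\<^sub>R x - h i" for i x
  define R where "R i = \<rho> i ` Z i" for i
  have sg: "sgn (x \<bullet> h i) * (x \<bullet> h i) = 1/3" "sgn (x \<bullet> h i) = 1 \<or> sgn (x \<bullet> h i) = -1"
    if "x \<in> Z i" "i < 3" for x i
    using Zval(1)[OF that] by (auto simp: sgn_if abs_if split: if_splits)
  have RH: "w \<bullet> h j = 0" "h j \<bullet> w = 0" if w: "w \<in> R i" "i < 3" "j < 3" for w i j
  proof -
    obtain x where x: "x \<in> Z i" "w = \<rho> i x" using w by (auto simp: R_def)
    show "w \<bullet> h j = 0"
      using sg[OF x(1) w(2)] Zval(2)[OF x(1) w(2) w(3)] hh[OF w(2,3)]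
      by (cases "j = i") (auto simp: x(2) \<rho>_def inner_simps)
    then show "h j \<bullet> w = 0" by (simp add: inner_commute)
  qed
  have inj: "inj_on (\<rho> i) (Z i)" if "i < 3" for i
  proof (rule inj_onI)
    fix x y assume xy: "x \<in> Z i" "y \<in> Z i" "\<rho> i x = \<rho> i y"
    then have "x = y \<or> x = - y"
      using sg(2)[OF xy(1) that] sg(2)[OF xy(2) that] by (auto simp: \<rho>_def)
    moreover have "x \<in> X" "y \<in> X" "y \<noteq> 0" using xy un[of y] by (auto simp: Z_def)
    ultimately show "x = y" using nopp[of y] by auto
  qed
  have \<rho>\<rho>: "\<rho> i x \<bullet> \<rho> j y = sgn (x \<bullet> h i) * sgn (y \<bullet> h j) * (x \<bullet> y) - (if i = j then 1/3 else 0)"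
    if "x \<in> Z i" "y \<in> Z j" "i < 3" "j < 3" for x y i j
  proof -
    have "\<rho> i x \<bullet> h j = 0" using RH(1)[of "\<rho> i x" i j] that by (auto simp: R_def)
    then have "\<rho> i x \<bullet> \<rho> j y = sgn (y \<bullet> h j) * (\<rho> i x \<bullet> y)"
      by (simp add: \<rho>_def[of j] inner_simps)
    also have "\<dots> = sgn (x \<bullet> h i) * sgn (y \<bullet> h j) * (x \<bullet> y) - sgn (y \<bullet> h j) * (y \<bullet> h i)"
      by (simp add: \<rho>_def inner_simps inner_commute[of "h i"] algebra_simps)
    also have "sgn (y \<bullet> h j) * (y \<bullet> h i) = (if i = j then 1/3 else 0)"
      using sg(1)[OF that(2,4)] Zval(2)[OF that(2,4) that(3)] by auto
    finally show ?thesis .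
  qed
  have Rn: "w \<bullet> w = 2/3" if w: "w \<in> R i" "i < 3" for w i
  proof -
    obtain x where x: "x \<in> Z i" "w = \<rho> i x" using w by (auto simp: R_def)
    then have "x \<bullet> x = 1" using un by (auto simp: Z_def)
    then show ?thesis using \<rho>\<rho>[OF x(1) x(1) w(2) w(2)] sg(2)[OF x(1) w(2)] x(2) by auto
  qed
  have Rs: "v \<bullet> w \<in> {0, -2/3}" if vw: "v \<in> R i" "w \<in> R i" "v \<noteq> w" "i < 3" for v w i
  proof -
    obtain x y where x: "x \<in> Z i" "v = \<rho> i x" "y \<in> Z i" "w = \<rho> i y" using vw by (auto simp: R_def)
    then have "x \<bullet> y = 1/3 \<or> x \<bullet> y = -1/3" using vw ip[of x y] by (auto simp: Z_def)
    then show ?thesis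
      using \<rho>\<rho>[OF x(1,3) vw(4,4)] sg(2)[OF x(1) vw(4)] sg(2)[OF x(3) vw(4)] x by auto
  qed
  have Rc: "v \<bullet> w \<in> {1/3, -1/3}" if vw: "v \<in> R i" "w \<in> R j" "i \<noteq> j" "i < 3" "j < 3" for v w i j
  proof -
    obtain x y where x: "x \<in> Z i" "v = \<rho> i x" "y \<in> Z j" "w = \<rho> j y" using vw by (auto simp: R_def)
    have "x \<noteq> y" using x Zval(1)[of x i] Zval(2)[of y j i] vw by auto
    then have "x \<bullet> y = 1/3 \<or> x \<bullet> y = -1/3" using ip[of x y] x by (auto simp: Z_def)
    then show ?thesis
      using \<rho>\<rho>[OF x(1,3) vw(4,5)] sg(2)[OF x(1) vw(4)] sg(2)[OF x(3) vw(5)] x vw(3) by auto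
  qed
  define H where "H = h ` {..<3}"
  define U where "U = R 0 \<union> R 1 \<union> R 2"
  have U: "w \<in> U \<longleftrightarrow> (\<exists>i<3. w \<in> R i)" for w by (auto simp: U_def less3)
  have injh: "inj_on h {..<3}"
  proof (rule inj_onI)
    fix i j assume "i \<in> {..<3}" "j \<in> {..<3}" "h i = h j"
    then show "i = j" using hh[of i j] hh[of i i] by (auto split: if_splits)
  qed
  have "pairwise orthogonal H"
    unfolding H_def by (auto simp: pairwise_def orthogonal_def hh split: if_splits)
  moreover have "0 \<notin> H" using hh by (force simp: H_def)
  ultimately have "independent H" by (rule pairwise_orthogonal_independent)
  then have "dim H = 3" using card_image[OF injh] by (simp add: dim_eq_card_independent H_def)
  moreover have "dim (H \<union> U) = dim H + dim U"
    by (rule dim_orthogonal_sum) (auto simp: H_def U RH)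
  ultimately have dHU: "dim (H \<union> U) = 3 + dim U" by simp
  have "\<rho> i x \<in> span X" if "i < 3" "x \<in> Z i" for i x
  proof -
    have "x \<in> span X" using that by (auto simp: Z_def span_base)
    then show ?thesis unfolding \<rho>_def using hsp[OF that(1)] by (intro span_diff span_scale)
  qed
  then have "H \<union> U \<subseteq> span X"
    using hsp by (auto simp: H_def U R_def)
  then have le1: "3 + dim U \<le> dim X" using dHU dim_subset[of "H \<union> U" "span X"] by simp
  have hHU: "h i \<in> span (H \<union> U)" if "i < 3" for i
    using that by (auto simp: H_def intro!: span_base)
  have "X \<subseteq> span (H \<union> U)"
  proof
    fix x assume x: "x \<in> X"
    show "x \<in> span (H \<union> U)"
    proof (cases "x \<in> P")
      case True
      have "2 *\<^sub>R a = 2 *\<^sub>R (h 1 + h 2 - h 0)" "2 *\<^sub>R p2 = 2 *\<^sub>R (h 0 + h 2 - h 1)"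
        "2 *\<^sub>R p3 = 2 *\<^sub>R (h 0 + h 1 - h 2)" "2 *\<^sub>R (a + p2 + p3) = 2 *\<^sub>R (h 0 + h 1 + h 2)"
        unfolding h by (simp_all add: scaleR_add_right scaleR_diff_right scaleR_2)
      then have e: "a = h 1 + h 2 - h 0" "p2 = h 0 + h 2 - h 1" "p3 = h 0 + h 1 - h 2"
        "a + p2 + p3 = h 0 + h 1 + h 2"
        by (simp_all only: scaleR_cancel_left) simp_all
      have "h 1 + h 2 - h 0 \<in> span (H \<union> U)" "h 0 + h 2 - h 1 \<in> span (H \<union> U)"
        "h 0 + h 1 - h 2 \<in> span (H \<union> U)" "h 0 + h 1 + h 2 \<in> span (H \<union> U)"
        by (intro span_diff span_add hHU; simp)+
      then have "Q \<subseteq> span (H \<union> U)"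
        unfolding Q_def by (simp only: e(4)) (simp only: e(1-3)[symmetric] insert_subset empty_subsetI simp_thms)
      then have "x \<in> span (H \<union> U) \<or> - x \<in> span (H \<union> U)" using True by (auto simp: P_def)
      then show ?thesis using span_neg[of "- x"] by auto
    next
      case False
      then obtain i where i: "i < 3" "x \<in> Z i" using pillar[of x] x by (auto simp: Z_def)
      have "\<rho> i x \<in> R i" using i(2) by (simp add: R_def)
      then have "\<rho> i x \<in> U" using i(1) unfolding U by blast
      then have "\<rho> i x \<in> span (H \<union> U)" by (simp add: span_base)
      then have "\<rho> i x + h i \<in> span (H \<union> U)" using hHU[OF i(1)] by (rule span_add)
      then have "sgn (x \<bullet> h i) *\<^sub>R x \<in> span (H \<union> U)" by (simp add: \<rho>_def)
      then show ?thesis using sg(2)[OF i(2,1)] span_neg[of "- x"] by auto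
    qed
  qed
  then have le2: "dim X \<le> 3 + dim U" using dHU dim_subset[of X "span (H \<union> U)"] by simp
  have big: "\<not> dim U \<le> 4" using le2 dim by simp
  have alone: "R j = {} \<and> R k = {}"
    if ijk: "i < 3" "j < 3" "k < 3" "i \<noteq> j" "i \<noteq> k" "j \<noteq> k" "dim (R j) \<le> dim (R i)" "dim (R k) \<le> dim (R i)"
      "U = R i \<union> R j \<union> R k" for i j k
  proof (rule ccontr)
    assume "\<not> (R j = {} \<and> R k = {})"
    then have "dim (R i \<union> R j \<union> R k) \<le> 4"
      using ijk by (intro dim_three_pillars_le) (auto simp: Rn dest: Rs Rc)
    then show False using big ijk by simp
  qed
  have single: "\<exists>i<3. \<forall>j<3. j \<noteq> i \<longrightarrow> R j = {}"
  proof -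
    have ex3: "(\<exists>i<3. F i) \<longleftrightarrow> F 0 \<or> F 1 \<or> F 2" "(\<forall>i<3. F i) \<longleftrightarrow> F 0 \<and> F 1 \<and> F 2" for F :: "nat \<Rightarrow> bool"
      by (auto simp: less3)
    consider "dim (R 1) \<le> dim (R 0)" "dim (R 2) \<le> dim (R 0)" | "dim (R 0) \<le> dim (R 1)" "dim (R 2) \<le> dim (R 1)"
      | "dim (R 0) \<le> dim (R 2)" "dim (R 1) \<le> dim (R 2)" by linarith
    then show ?thesis
    proof cases
      case 1 then show ?thesis unfolding ex3 using alone[of 0 1 2] by (simp add: U_def)
    next
      case 2 then show ?thesis unfolding ex3 using alone[of 1 0 2] by (simp add: U_def Un_ac)
    next
      case 3 then show ?thesis unfolding ex3 using alone[of 2 0 1] by (simp add: U_def Un_ac)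
    qed
  qed
  then obtain i where i: "i < 3" "\<And>j. j < 3 \<Longrightarrow> j \<noteq> i \<Longrightarrow> R j = {}" by blast
  have "U = R i"
  proof (intro equalityI subsetI)
    fix w assume "w \<in> U"
    then obtain k where "k < 3" "w \<in> R k" unfolding U by blast
    then show "w \<in> R i" using i(2)[of k] by (cases "k = i") auto
  next
    fix w assume "w \<in> R i"
    then show "w \<in> U" using i(1) unfolding U by blast
  qed
  have "X - P \<subseteq> Z i"
  proof
    fix x assume x: "x \<in> X - P"
    then obtain k where k: "k < 3" "x \<in> Z k" using pillar[of x] by (auto simp: Z_def)
    then have "R k \<noteq> {}" by (auto simp: R_def)
    then show "x \<in> Z i" using i(2)[of k] k by (cases "k = i") auto
  qed
  then have "X \<subseteq> P \<union> Z i" by blast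
  then have "card X \<le> card (P \<union> Z i)" using fin by (intro card_mono) (auto simp: P_def Z_def)
  also have "\<dots> \<le> card P + card (Z i)" by (rule card_Un_le)
  also have "card (Z i) = card (R i)" unfolding R_def using card_image[OF inj[OF i(1)]] by simp
  also have "card (R i) \<le> 2 * dim (R i)"
    using i(1) by (intro card_orthogonal_or_opposite_le) (auto simp: Rn dest: Rs)
  finally show ?thesis using cP le1 \<open>U = R i\<close> by simp
qed

text \<open>
  In the absence of a negative triple the set is a basis of its span, which is even smaller.
\<close>

lemma equiangular_third_card_le:
  fixes X :: "'a::euclidean_space set"
  assumes fin: "finite X" and un: "\<And>x. x \<in> X \<Longrightarrow> x \<bullet> x = 1"
    and ip: "\<And>x y. x \<in> X \<Longrightarrow> y \<in> X \<Longrightarrow> x \<noteq> y \<Longrightarrow> x \<bullet> y \<in> {1/3, -1/3}"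
    and dim: "dim X \<ge> 8"
  shows "card X \<le> 2 * (dim X - 1)"
proof (cases "\<exists>a\<in>X. \<exists>b\<in>X. \<exists>c\<in>X. a \<noteq> b \<and> b \<noteq> c \<and> a \<noteq> c \<and> (a \<bullet> b) * (b \<bullet> c) * (c \<bullet> a) < 0")
  case True
  then show ?thesis using card_le_if_negative_triple[OF fin un ip _ _ _ _ _ _ _ dim] by blast
next
  case False
  have "independent X"
  proof (rule independent_if_all_triples_positive[OF fin un, of "1/3"])
    fix x y assume "x \<in> X" "y \<in> X" "x \<noteq> y"
    then show "x \<bullet> y \<in> {1/3, -(1/3)}" using ip[of x y] by simp
  next
    fix x y z assume *: "x \<in> X" "y \<in> X" "z \<in> X" "x \<noteq> y" "y \<noteq> z" "x \<noteq> z"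
    have "(x \<bullet> y) * (y \<bullet> z) * (z \<bullet> x) \<noteq> 0" using * ip[of x y] ip[of y z] ip[of z x] by auto
    then show "(x \<bullet> y) * (y \<bullet> z) * (z \<bullet> x) > 0" using False * by (metis linorder_neqE_linordered_idom)
  qed auto
  then have "card X = dim X" by (simp add: dim_eq_card_independent)
  then show ?thesis using dim by simp
qed

section \<open>Integral matrices of even order\<close>

text \<open>
  Modulo \<open>2\<close> the matrix is \<open>J - I\<close>, and \<open>(J - I)\<^sup>2 = (k - 2) J + I\<close> is the identity when \<open>k\<close> is even.
\<close>

lemma det_ne_0_even_diag_odd_off_diag:
  fixes M :: "int mat"
  assumes M: "M \<in> carrier_mat k k" and k: "even k"
    and d: "\<And>i. i < k \<Longrightarrow> even (M $$ (i, i))"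
    and o: "\<And>i j. i < k \<Longrightarrow> j < k \<Longrightarrow> i \<noteq> j \<Longrightarrow> odd (M $$ (i, j))"
  shows "det M \<noteq> 0"
proof
  assume "det M = 0"
  interpret B: comm_ring_hom "of_int :: int \<Rightarrow> bit" by unfold_locales auto
  have ob: "(of_int a :: bit) = (if even a then 0 else 1)" for a
    by (cases "even a") (auto elim!: evenE oddE)
  have onb: "(of_nat a :: bit) = (if even a then 0 else 1)" for a
    using ob[of "int a"] by simp
  define N where "N = map_mat (of_int :: int \<Rightarrow> bit) M"
  have N: "N \<in> carrier_mat k k" using M by (simp add: N_def)
  have Nij: "N $$ (i, j) = (if i = j then 0 else 1)" if "i < k" "j < k" for i j
    using that M d[of i] o[of i j] by (cases "i = j") (simp_all add: N_def ob)
  have "N * N = 1\<^sub>m k"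
  proof (rule eq_matI)
    fix i j assume "i < dim_row (1\<^sub>m k)" "j < dim_col (1\<^sub>m k)"
    then have ij: "i < k" "j < k" by auto
    have "(N * N) $$ (i, j) = (\<Sum>l<k. N $$ (i, l) * N $$ (l, j))"
      using N ij by (simp add: scalar_prod_def atLeast0LessThan)
    also have "\<dots> = (\<Sum>l<k. if l \<in> {i, j} then 0 else 1)"
      by (intro sum.cong refl) (auto simp: Nij ij)
    also have "\<dots> = (\<Sum>l\<in>{..<k} - {i, j}. 1)"
      by (intro sum.mono_neutral_cong_right) auto
    also have "\<dots> = of_nat (card ({..<k} - {i, j}))" by simp
    also have "card ({..<k} - {i, j}) = k - card {i, j}"
      using ij by (subst card_Diff_subset) auto
    also have "(of_nat (k - card {i, j}) :: bit) = (if i = j then 1 else 0)"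
      proof (cases "i = j")
      case True
      then have "card {i, j} = 1" "k \<ge> 1" using ij by simp_all
      then show ?thesis using k True by (simp add: onb)
    next
      case False
      then have "card {i, j} = 2" "k \<ge> 2" using ij by auto
      then show ?thesis using k False by (simp add: onb)
    qed
    finally show "(N * N) $$ (i, j) = 1\<^sub>m k $$ (i, j)" using ij by simp
  qed (use N in auto)
  then have "det N * det N = 1" using det_mult[OF N N] by simp
  moreover have "det N = of_int (det M)" unfolding N_def by simp
  ultimately show False using \<open>det M = 0\<close> by simp
qed

section \<open>Eigenvalues of high multiplicity\<close>

text \<open>
  The last \<open>n - r\<close> columns of a unitriangular matrix \<open>U\<close> are eigenvectors of \<open>A\<close>. Multiplying
  \<open>x I - A\<close> by \<open>U\<close> leaves the determinant unchanged and makes these columns divisible by \<open>x - e\<close>.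
\<close>

lemma char_poly_dvd_if_eigenvector_columns:
  fixes A U :: "'a :: field mat"
  assumes A: "A \<in> carrier_mat n n" and U: "U \<in> carrier_mat n n" "upper_triangular U"
    "\<And>i. i < n \<Longrightarrow> U $$ (i, i) = 1" and r: "r \<le> n"
    and ev: "\<And>i j. i < n \<Longrightarrow> r \<le> j \<Longrightarrow> j < n \<Longrightarrow> (\<Sum>k<n. A $$ (i, k) * U $$ (k, j)) = e * U $$ (i, j)"
  shows "[:- e, 1:] ^ (n - r) dvd char_poly A"
proof -
  define V where "V = map_mat (\<lambda>a. [:a:]) U"
  define M where "M = char_poly_matrix A * V"
  define M' where "M' = mat n n (\<lambda>(i, j). if j < r then M $$ (i, j) else [:U $$ (i, j):])"
  define D where "D = mat n n (\<lambda>(i, j). if i = j then if j < r then 1 else [:- e, 1:] else (0 :: 'a poly))"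
  have C: "char_poly_matrix A \<in> carrier_mat n n" "V \<in> carrier_mat n n" "M \<in> carrier_mat n n"
    "M' \<in> carrier_mat n n" "D \<in> carrier_mat n n"
    using A U(1) mult_carrier_mat[of "char_poly_matrix A" n n "map_mat (\<lambda>a. [:a:]) U" n]
    by (simp_all add: V_def M_def M'_def D_def)
  have "det V = prod_list (diag_mat V)"
    using U by (intro det_upper_triangular[of _ n]) (auto simp: V_def upper_triangular_def)
  also have "\<dots> = (\<Prod>i<n. V $$ (i, i))"
    using C(2) by (simp add: prod_list_diag_prod atLeast0LessThan)
  also have "\<dots> = 1" using U by (intro prod.neutral) (auto simp: V_def)
  finally have "det M = char_poly A"
    unfolding M_def using C by (simp add: det_mult char_poly_def)
  have Mij: "M $$ (i, j) = [:- (\<Sum>k<n. A $$ (i, k) * U $$ (k, j)), U $$ (i, j):]" if ij: "i < n" "j < n" for i j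
  proof -
    have "M $$ (i, j) = (\<Sum>k<n. char_poly_matrix A $$ (i, k) * V $$ (k, j))"
      using C ij by (simp add: M_def scalar_prod_def atLeast0LessThan)
    also have "\<dots> = (\<Sum>k<n. (if k = i then [:0, U $$ (i, j):] else 0) + [:- (A $$ (i, k) * U $$ (k, j)):])"
      using A U(1) ij by (intro sum.cong refl) (auto simp: char_poly_matrix_def V_def)
    also have "\<dots> = [:0, U $$ (i, j):] + (\<Sum>k<n. [:- (A $$ (i, k) * U $$ (k, j)):])"
      using ij by (simp add: sum.distrib)
    also have "(\<Sum>k<n. [:- (A $$ (i, k) * U $$ (k, j)):]) = [:- (\<Sum>k<n. A $$ (i, k) * U $$ (k, j)):]"
      by (simp add: sum_negf[symmetric] monom_0[symmetric] monom_sum)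
    finally show ?thesis by simp
  qed
  have "M = M' * D"
  proof (rule eq_matI)
    fix i j assume "i < dim_row (M' * D)" "j < dim_col (M' * D)"
    then have ij: "i < n" "j < n" using C by auto
    have "(M' * D) $$ (i, j) = (\<Sum>k<n. M' $$ (i, k) * D $$ (k, j))"
      using C ij by (simp add: scalar_prod_def atLeast0LessThan)
    also have "\<dots> = (\<Sum>k<n. if k = j then M' $$ (i, j) * D $$ (j, j) else 0)"
      using ij by (intro sum.cong refl) (auto simp: D_def)
    also have "\<dots> = M' $$ (i, j) * D $$ (j, j)" using ij by simp
    also have "\<dots> = M $$ (i, j)"
      using ij Mij[OF ij] ev[OF ij(1) _ ij(2)] by (auto simp: M'_def D_def)
    finally show "M $$ (i, j) = (M' * D) $$ (i, j)" ..
  qed (use C in auto)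
  then have "det M = det M' * det D" using C by (simp add: det_mult)
  moreover have "det D = [:- e, 1:] ^ (n - r)"
  proof -
    have "det D = prod_list (diag_mat D)"
      by (intro det_upper_triangular[of _ n]) (auto simp: D_def upper_triangular_def)
    also have "\<dots> = (\<Prod>i<n. D $$ (i, i))"
      using C(5) by (simp add: prod_list_diag_prod atLeast0LessThan)
    also have "\<dots> = (\<Prod>i<n. if i < r then 1 else [:- e, 1:])"
      by (intro prod.cong refl) (auto simp: D_def)
    also have "\<dots> = (\<Prod>i\<in>{r..<n}. [:- e, 1:])"
      by (intro prod.mono_neutral_cong_right) auto
    finally show ?thesis by simp
  qed
  ultimately show ?thesis using \<open>det M = char_poly A\<close> by simp
qed

text \<open>
  An annihilating polynomial \<open>q\<close> of \<open>e\<close> of minimal degree divides every rational polynomial that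
  vanishes at \<open>e\<close>. It does not share the root \<open>e\<close> with its derivative, which has smaller degree.
  So dividing a polynomial by \<open>q\<close> lowers the multiplicity of the root \<open>e\<close> by exactly one.
\<close>

lemma minimal_rational_polynomial_power_dvd:
  fixes e :: real and p :: "rat poly"
  assumes p0: "p \<noteq> 0" and pe: "poly (map_poly of_rat p) e = 0"
  obtains q :: "rat poly" where "monic q" "poly (map_poly of_rat q) e = 0"
    "\<And>g :: rat poly. g \<noteq> 0 \<Longrightarrow> poly (map_poly of_rat g) e = 0 \<Longrightarrow> degree q \<le> degree g"
    "\<And>f k. [:- e, 1:] ^ k dvd map_poly of_rat f \<Longrightarrow> q ^ k dvd f"
proof -
  interpret R: map_poly_inj_idom_hom "of_rat :: rat \<Rightarrow> real" ..
  let ?R = "map_poly (of_rat :: rat \<Rightarrow> real)"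
  let ?ann = "\<lambda>g. g \<noteq> 0 \<and> poly (?R g) e = 0"
  obtain g where g: "?ann g" "\<And>h. ?ann h \<Longrightarrow> degree g \<le> degree h"
    using ex_has_least_nat[of ?ann p degree] p0 pe by blast
  define q where "q = Polynomial.smult (inverse (lead_coeff g)) g"
  have lg: "lead_coeff g \<noteq> 0" using g(1) by simp
  have q: "monic q" "poly (?R q) e = 0" "degree q = degree g"
    using lg g(1) by (auto simp: q_def hom_distribs)
  have min: "degree q \<le> degree h" if "h \<noteq> 0" "poly (?R h) e = 0" for h
    using g(2)[of h] that q(3) by simp
  have q0: "q \<noteq> 0" using q(1) by auto
  have dvd: "q dvd f" if "poly (?R f) e = 0" for f
  proof (rule ccontr)
    assume "\<not> q dvd f"
    then have n: "f mod q \<noteq> 0" by (simp add: dvd_eq_mod_eq_0)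
    have "f = (f div q) * q + f mod q" by simp
    then have "?R f = ?R (f div q) * ?R q + ?R (f mod q)" by (metis R.hom_add R.hom_mult)
    then have "poly (?R (f mod q)) e = 0" using that q(2) by simp
    then have "degree q \<le> degree (f mod q)" using min n by blast
    moreover have "degree (f mod q) < degree q" using degree_mod_less'[of q f] q0 n by simp
    ultimately show False by simp
  qed
  obtain h where h: "?R q = [:- e, 1:] * h"
    using q(2) by (metis poly_eq_0_iff_dvd dvdE)
  have dq: "degree q > 0"
  proof (rule ccontr)
    assume "\<not> degree q > 0"
    then have "q = 1" using q(1) by (metis monic_degree_0 neq0_conv)
    then show False using q(2) by simp
  qed
  have he: "poly h e \<noteq> 0"
  proof
    assume "poly h e = 0"
    then have "poly (pderiv (?R q)) e = 0" unfolding h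
      by (simp only: pderiv_mult poly_add poly_mult) (simp add: pderiv_pCons)
    moreover have "pderiv (?R q) = ?R (pderiv q)"
      by (rule poly_eqI) (simp add: coeff_pderiv of_rat_mult of_rat_add)
    moreover have "pderiv q \<noteq> 0" using dq by (simp add: pderiv_eq_0_iff)
    ultimately have "degree q \<le> degree (pderiv q)" using min by simp
    then show False using dq by (simp add: degree_pderiv)
  qed
  have "q ^ k dvd f" if "[:- e, 1:] ^ k dvd ?R f" for f k
    using that
  proof (induction k arbitrary: f)
    case (Suc k)
    have "[:- e, 1:] dvd ?R f" using Suc.prems by (metis dvd_mult_left power_Suc)
    then have "poly (?R f) e = 0" by (simp add: poly_eq_0_iff_dvd)
    then obtain f1 where f1: "f = q * f1" using dvd by blast
    then have "?R f = [:- e, 1:] * (h * ?R f1)" by (simp only: R.hom_mult h mult.assoc)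
    then have "[:- e, 1:] * [:- e, 1:] ^ k dvd [:- e, 1:] * (h * ?R f1)" using Suc.prems by simp
    then have d: "[:- e, 1:] ^ k dvd h * ?R f1" by (subst (asm) dvd_mult_cancel_left) simp
    have "[:- e, 1:] ^ k dvd ?R f1"
    proof (cases "?R f1 = 0")
      case False
      moreover have "h \<noteq> 0" "Polynomial.order e h = 0" using he by (auto simp: order_root)
      ultimately have "Polynomial.order e (h * ?R f1) = Polynomial.order e (?R f1)" by (simp add: order_mult)
      then show ?thesis using d False \<open>h \<noteq> 0\<close> by (simp add: order_divides)
    qed simp
    then have "q ^ k dvd f1" by (rule Suc.IH)
    then show ?case unfolding f1 by (simp add: mult_dvd_mono)
  qed simp
  then show ?thesis using that[OF q(1,2) min] by blast
qed

text \<open>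
  Since \<open>n < 3 m\<close>, the minimal polynomial of \<open>e\<close> has degree \<open>1\<close> or \<open>2\<close>. In the first case \<open>e\<close> is a
  rational algebraic integer. In the second case the other root \<open>e'\<close> is the conjugate of \<open>e\<close>.
\<close>

lemma multiple_root_of_monic_int_poly:
  fixes e :: real and p :: "int poly"
  assumes p: "monic p" "degree p = n" and dvd: "[:- e, 1:] ^ m dvd map_poly of_int p"
    and m: "0 < m" "n < 3 * m"
  shows "e \<in> \<int> \<or> (e \<notin> \<rat> \<and> 2 * m \<le> n \<and> (\<exists>e' s. e + e' \<in> \<rat> \<and>
    map_poly of_int p = ([:- e, 1:] * [:- e', 1:]) ^ m * map_poly of_rat s))"
proof -
  interpret R: map_poly_inj_idom_hom "of_rat :: rat \<Rightarrow> real" ..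
  let ?R = "map_poly (of_rat :: rat \<Rightarrow> real)"
  define P :: "rat poly" where "P = map_poly of_int p"
  have RP: "?R P = map_poly of_int p"
    by (rule poly_eqI) (simp add: P_def)
  have P: "P \<noteq> 0" "degree P = n" using p by (auto simp: P_def)
  have "[:- e, 1:] dvd [:- e, 1:] ^ m" using m(1) by (intro dvd_power) auto
  then have "[:- e, 1:] dvd ?R P" using dvd unfolding RP by (rule dvd_trans)
  then have Pe: "poly (?R P) e = 0" by (simp add: poly_eq_0_iff_dvd)
  obtain q where q: "monic q" "poly (?R q) e = 0"
    "\<And>g. g \<noteq> 0 \<Longrightarrow> poly (?R g) e = 0 \<Longrightarrow> degree q \<le> degree g"
    "\<And>f k. [:- e, 1:] ^ k dvd ?R f \<Longrightarrow> q ^ k dvd f"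
    using minimal_rational_polynomial_power_dvd[OF P(1) Pe] by metis
  obtain s where s: "P = q ^ m * s" using q(4)[of m P] dvd unfolding RP by blast
  have q0: "q \<noteq> 0" "s \<noteq> 0" using s P(1) m(1) by (auto simp: power_0_left)
  then have "n = m * degree q + degree s"
    using P(2) unfolding s by (simp add: degree_mult_eq degree_power_eq mult.commute)
  moreover have "degree q \<noteq> 0"
  proof
    assume "degree q = 0"
    then have "q = 1" using q(1) by (metis monic_degree_0)
    then show False using q(2) by simp
  qed
  moreover have "degree q < 3"
  proof (rule ccontr)
    assume "\<not> degree q < 3"
    then have "m * 3 \<le> m * degree q" by (intro mult_le_mono2) simp
    then show False using m(2) \<open>n = _\<close> by linarith
  qed
  ultimately have "degree q = 1 \<or> degree q = 2 \<and> 2 * m \<le> n"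
    by (cases "degree q = 2") auto
  then consider "degree q = 1" | "degree q = 2" "2 * m \<le> n" by blast
  then show ?thesis
  proof cases
    case 1
    then obtain c where c: "q = [:c, 1:]" using q(1)
      by (metis degree1_coeffs coeff_pCons_Suc coeff_pCons_0 One_nat_def lead_coeff_pCons(1) pCons_eq_0_iff)
    then have "e = of_rat (- c)" using q(2) by (simp add: hom_distribs of_rat_minus)
    then have "e \<in> \<rat>" by simp
    moreover have "algebraic_int e"
      unfolding algebraic_int_altdef_ipoly using Pe p(1) unfolding RP by blast
    ultimately show ?thesis using rational_algebraic_int_is_int by blast
  next
    case 2
    have irr: "e \<notin> \<rat>"
    proof
      assume "e \<in> \<rat>"
      then obtain c where "e = of_rat c" by (auto elim: Rats_cases)
      then have "poly (?R [:- c, 1:]) e = 0" by (simp add: hom_distribs of_rat_minus)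
      then have "degree q \<le> degree [:- c, 1:]" using q(3)[of "[:- c, 1:]"] by simp
      then show False using 2 by simp
    qed
    obtain b c where q': "q = [:c, b, 1:]"
    proof -
      obtain a b c where abc: "q = [:c, b, a:]" using degree2_coeffs[OF 2(1)] by metis
      have "coeff q 2 = 1" using q(1) 2(1) by simp
      then have "a = 1" by (simp add: abc numeral_2_eq_2)
      then show ?thesis using that abc by simp
    qed
    have "?R q = [:- e, 1:] * [:- (- of_rat b - e), 1:]"
    proof -
      have "of_rat c + e * (of_rat b + e) = 0"
        using q(2) by (simp add: q' hom_distribs)
      then have "of_rat c = e * (- of_rat b - e)" by (simp add: algebra_simps)
      then show ?thesis by (simp add: q' hom_distribs algebra_simps)
    qed
    then have "map_poly of_int p = ([:- e, 1:] * [:- (- of_rat b - e), 1:]) ^ m * ?R s"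
      unfolding RP[symmetric] s by (simp only: R.hom_mult R.hom_power)
    moreover have "e + (- of_rat b - e) \<in> \<rat>" by simp
    ultimately show ?thesis using irr 2(2) by blast
  qed
qed

section \<open>Quadratic eigenvalues\<close>

definition tr :: "real mat \<Rightarrow> real" where
  "tr A = (\<Sum>i<dim_row A. A $$ (i, i))"

lemma mult_index_sum:
  assumes "A \<in> carrier_mat n n" "B \<in> carrier_mat n n" "i < n" "j < n"
  shows "(A * B) $$ (i, j) = (\<Sum>k<n. A $$ (i, k) * B $$ (k, j))"
  using assms by (simp add: scalar_prod_def atLeast0LessThan)

lemma tr_mult_commute:
  assumes "A \<in> carrier_mat n n" "B \<in> carrier_mat n n"
  shows "tr (A * B) = tr (B * A)"
proof -
  have "tr (A * B) = (\<Sum>i<n. \<Sum>k<n. A $$ (i, k) * B $$ (k, i))"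
    using assms unfolding tr_def by (intro sum.cong) (auto simp: mult_index_sum[of _ n] simp del: index_mult_mat(1))
  also have "\<dots> = (\<Sum>k<n. \<Sum>i<n. A $$ (i, k) * B $$ (k, i))" by (rule sum.swap)
  also have "\<dots> = tr (B * A)"
    using assms unfolding tr_def by (intro sum.cong) (auto simp: mult_index_sum[of _ n] mult.commute simp del: index_mult_mat(1))
  finally show ?thesis .
qed

context
  fixes P Q :: "real mat" and n :: nat
  assumes PC: "P \<in> carrier_mat n n" and QC: "Q \<in> carrier_mat n n"
    and PQ: "P * Q = 1\<^sub>m n" and QP: "Q * P = 1\<^sub>m n"
begin

text \<open>
  \<open>Q A P\<close> is upper triangular with diagonal \<open>d\<close>, where \<open>Q\<close> is the inverse of \<open>P\<close>. For fixed \<open>P\<close> this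
  notion is compatible with sums and products. So if \<open>S\<close> is triangularized with diagonal \<open>d\<close>, then a
  polynomial in \<open>S\<close> is triangularized with its values at \<open>d\<close> as diagonal, which gives its trace.
\<close>

definition triangularized :: "real mat \<Rightarrow> (nat \<Rightarrow> real) \<Rightarrow> bool" where
  "triangularized A d \<longleftrightarrow> A \<in> carrier_mat n n \<and> (\<forall>i<n. \<forall>j<i. (Q * A * P) $$ (i, j) = 0) \<and>
     (\<forall>i<n. (Q * A * P) $$ (i, i) = d i)"

lemma conj_mult:
  assumes "A \<in> carrier_mat n n" "B \<in> carrier_mat n n"
  shows "Q * (A * B) * P = (Q * A * P) * (Q * B * P)"
proof -
  have "(Q * A * P) * (Q * B * P) = Q * A * (P * Q) * (B * P)"
    using assms PC QC by (simp add: assoc_mult_mat[of _ n n _ n _ n])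
  then show ?thesis using assms PC QC by (simp add: PQ assoc_mult_mat[of _ n n _ n _ n])
qed

lemma triangularized_mult:
  assumes A: "triangularized A d" and B: "triangularized B d'"
  shows "triangularized (A * B) (\<lambda>i. d i * d' i)"
proof -
  have AC: "A \<in> carrier_mat n n" and BC: "B \<in> carrier_mat n n"
    using A B by (auto simp: triangularized_def)
  let ?A = "Q * A * P" and ?B = "Q * B * P"
  have C: "?A \<in> carrier_mat n n" "?B \<in> carrier_mat n n" using AC BC PC QC by auto
  have e: "(Q * (A * B) * P) $$ (i, j) = (\<Sum>k<n. ?A $$ (i, k) * ?B $$ (k, j))" if "i < n" "j < n" for i j
    unfolding conj_mult[OF AC BC] using mult_index_sum[OF C that] .
  have z: "?A $$ (i, k) * ?B $$ (k, j) = (if k = i then if j = i then d i * d' i else 0 else 0)"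
    if "i < n" "k < n" "j \<le> i" for i j k
  proof -
    have "k < i \<or> j < k \<or> k = i \<and> j = i" using that(3) by auto
    then consider "k < i" | "j < k" | "k = i" "j = i" by blast
    then show ?thesis using that A B by cases (auto simp: triangularized_def)
  qed
  have "(Q * (A * B) * P) $$ (i, j) = (if j = i then d i * d' i else 0)" if "i < n" "j \<le> i" for i j
  proof -
    have "(\<Sum>k<n. ?A $$ (i, k) * ?B $$ (k, j)) = (\<Sum>k<n. if k = i then if j = i then d i * d' i else 0 else 0)"
      by (intro sum.cong refl z) (use that in auto)
    then show ?thesis using e[of i j] that by simp
  qed
  then show ?thesis using AC BC by (auto simp: triangularized_def)
qed

lemma triangularized_add:
  assumes A: "triangularized A d" and B: "triangularized B d'"
  shows "triangularized (A + B) (\<lambda>i. d i + d' i)"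
proof -
  have AC: "A \<in> carrier_mat n n" and BC: "B \<in> carrier_mat n n"
    using A B by (auto simp: triangularized_def)
  have "Q * (A + B) * P = Q * A * P + Q * B * P"
    using AC BC PC QC by (simp add: mult_add_distrib_mat[of _ n n] add_mult_distrib_mat[of _ n n])
  then have "(Q * (A + B) * P) $$ (i, j) = (Q * A * P) $$ (i, j) + (Q * B * P) $$ (i, j)"
    if "i < n" "j < n" for i j
    using that PC QC by (simp del: index_mult_mat(1))
  then show ?thesis using A B AC BC by (auto simp: triangularized_def simp del: index_mult_mat(1))
qed

lemma triangularized_smult:
  assumes A: "triangularized A d"
  shows "triangularized (c \<cdot>\<^sub>m A) (\<lambda>i. c * d i)"
proof -
  have AC: "A \<in> carrier_mat n n" using A by (auto simp: triangularized_def)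
  have "Q * (c \<cdot>\<^sub>m A) * P = c \<cdot>\<^sub>m (Q * A * P)"
    using AC PC QC by (simp add: mult_smult_distrib[of _ n n] mult_smult_assoc_mat[of _ n n])
  then have "(Q * (c \<cdot>\<^sub>m A) * P) $$ (i, j) = c * (Q * A * P) $$ (i, j)" if "i < n" "j < n" for i j
    using that PC QC by (simp del: index_mult_mat(1))
  then show ?thesis using A AC by (auto simp: triangularized_def simp del: index_mult_mat(1))
qed

lemma triangularized_one: "triangularized (1\<^sub>m n) (\<lambda>i. 1)"
  using PC QC by (auto simp: triangularized_def QP)

lemma tr_triangularized:
  assumes A: "triangularized A d"
  shows "tr A = (\<Sum>i<n. d i)"
proof -
  have AC: "A \<in> carrier_mat n n" using A by (auto simp: triangularized_def)
  have "tr (Q * A * P) = tr (P * (Q * A))"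
    using AC PC QC by (intro tr_mult_commute[of _ n]) auto
  also have "P * (Q * A) = A"
    using AC PC QC by (simp add: assoc_mult_mat[of _ n n _ n _ n, symmetric] PQ)
  finally have "tr A = tr (Q * A * P)" ..
  also have "\<dots> = (\<Sum>i<n. d i)"
    using A QC unfolding tr_def by (intro sum.cong) (auto simp: triangularized_def)
  finally show ?thesis .
qed

text \<open>
  The square of \<open>A\<close> has trace \<open>0\<close>, and by symmetry this trace is the sum of the squares of all
  entries. In combination with the closure properties above, this lemma serves as a substitute for
  the spectral theorem: a polynomial in a symmetric matrix is zero if it vanishes on the eigenvalues.
\<close>

lemma symmetric_nilpotent_eq_0:
  assumes A: "triangularized A (\<lambda>i. 0)" and sym: "transpose_mat A = A" and ij: "i < n" "j < n"
  shows "A $$ (i, j) = 0"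
proof -
  have AC: "A \<in> carrier_mat n n" using A by (auto simp: triangularized_def)
  have "0 = tr (A * A)" using tr_triangularized[OF triangularized_mult[OF A A]] by simp
  also have "\<dots> = (\<Sum>i<n. \<Sum>k<n. A $$ (i, k) * A $$ (k, i))"
    using AC unfolding tr_def by (intro sum.cong) (auto simp: mult_index_sum[of _ n] simp del: index_mult_mat(1))
  also have "\<dots> = (\<Sum>i<n. \<Sum>k<n. (A $$ (i, k))\<^sup>2)"
  proof (intro sum.cong refl)
    fix i k assume "i \<in> {..<n}" "k \<in> {..<n}"
    then have "A $$ (k, i) = A $$ (i, k)" using AC sym index_transpose_mat(1)[of k A i] by auto
    then show "A $$ (i, k) * A $$ (k, i) = (A $$ (i, k))\<^sup>2" by (simp add: power2_eq_square)
  qed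
  finally have "(\<Sum>k<n. (A $$ (i, k))\<^sup>2) = 0"
    using ij(1) by (simp add: sum_nonneg_eq_0_iff sum_nonneg)
  then show ?thesis using ij(2) by (simp add: sum_nonneg_eq_0_iff)
qed

end

lemma transpose_smult_mat: "transpose_mat (k \<cdot>\<^sub>m A) = k \<cdot>\<^sub>m transpose_mat A"
  by (rule eq_matI) auto

lemma sum_symmetric_eq_twice_lower:
  fixes t :: "nat \<Rightarrow> nat \<Rightarrow> int"
  assumes "\<And>i j. i < n \<Longrightarrow> j < n \<Longrightarrow> t i j = t j i" "\<And>i. i < n \<Longrightarrow> t i i = 0"
  shows "(\<Sum>j<n. \<Sum>k<n. t k j) = 2 * (\<Sum>j<n. \<Sum>k<j. t k j)"
  using assms
proof (induction n)
  case (Suc n)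
  have "(\<Sum>j<Suc n. \<Sum>k<Suc n. t k j) = (\<Sum>j<n. \<Sum>k<n. t k j) + (\<Sum>j<n. t n j) + (\<Sum>k<n. t k n) + t n n"
    by (simp add: sum.distrib)
  also have "(\<Sum>j<n. t n j) = (\<Sum>k<n. t k n)" using Suc.prems(1) by (intro sum.cong) auto
  also have "(\<Sum>j<n. \<Sum>k<n. t k j) = 2 * (\<Sum>j<n. \<Sum>k<j. t k j)" using Suc by simp
  finally show ?case using Suc.prems(2)[of n] by simp
qed simp

text \<open>
  Here \<open>t\<close> is a Seidel matrix of odd order \<open>n\<close> that has the all-one vector as an eigenvector. Counting
  all entries shows that the column sum \<open>L = m b\<close> is \<open>2\<close> modulo \<open>4\<close>: the sum \<open>F\<close> of the
  \<open>n (n - 1) / 2 = (2 m + 1) m\<close> entries above the diagonal is odd, and \<open>n L = 2 F\<close>.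
  On the other hand, comparing the quadratic relation at an entry \<open>1\<close> with that at an entry \<open>-1\<close>
  shows that \<open>b\<close> is an integer. So \<open>b\<close> is \<open>0\<close>, \<open>1\<close> or \<open>-1\<close>, and \<open>m b\<close> is \<open>0\<close> or odd.
\<close>

lemma no_sign_matrix_with_constant_column_sums:
  fixes t :: "nat \<Rightarrow> nat \<Rightarrow> int" and b \<mu> L :: real
  assumes n: "n = 2 * m + 1" and m: "odd m"
    and sym: "\<And>i j. i < n \<Longrightarrow> j < n \<Longrightarrow> t i j = t j i" and diag: "\<And>i. i < n \<Longrightarrow> t i i = 0"
    and off: "\<And>i j. i < n \<Longrightarrow> j < n \<Longrightarrow> i \<noteq> j \<Longrightarrow> t i j = 1 \<or> t i j = -1"
    and col: "\<And>j. j < n \<Longrightarrow> real_of_int (\<Sum>k<n. t k j) = real m * b"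
    and quad: "\<And>i j. i < n \<Longrightarrow> j < n \<Longrightarrow> i \<noteq> j \<Longrightarrow>
      real_of_int (\<Sum>k<n. t i k * t k j) + b * real_of_int (t i j) = \<mu>"
    and b: "b\<^sup>2 < 4"
  shows False
proof -
  have odd_off: "odd (t i j)" if "i < n" "j < n" "i \<noteq> j" for i j
    using off[OF that] by auto
  have m1: "m \<ge> 1" using m by (cases m) auto
  define L where "L = (\<Sum>k<n. t k 0)"
  have Lb: "real_of_int L = real m * b" using col[of 0] n by (simp add: L_def)
  have colL: "(\<Sum>k<n. t k j) = L" if "j < n" for j
  proof -
    have "real_of_int (\<Sum>k<n. t k j) = real_of_int L" using col[OF that] Lb by simp
    then show ?thesis by (simp only: of_int_eq_iff)
  qed
  define F where "F = (\<Sum>j<n. \<Sum>k<j. t k j)"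
  have "(\<Sum>j<n. \<Sum>k<n. t k j) = int n * L" using colL by simp
  then have nL: "int n * L = 2 * F" using sum_symmetric_eq_twice_lower[of n t] sym diag by (simp add: F_def)
  have inner: "odd (\<Sum>k<j. t k j) \<longleftrightarrow> odd j" if "j < n" for j
  proof -
    have "{k \<in> {..<j}. odd (t k j)} = {..<j}" using odd_off that by auto
    then show ?thesis by (simp add: even_sum_iff)
  qed
  have "card {j::nat. j < 2 * m + 1 \<and> odd j} = m"
  proof (induction m)
    case (Suc m)
    have "{j::nat. j < 2 * Suc m + 1 \<and> odd j} = insert (2 * m + 1) {j::nat. j < 2 * m + 1 \<and> odd j}"
    proof (intro Set.set_eqI iffI)
      fix j assume "j \<in> {j::nat. j < 2 * Suc m + 1 \<and> odd j}"
      then have "j < 2 * m + 3" "odd j" by auto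
      then have "j < 2 * m + 1 \<or> j = 2 * m + 1" by (cases "j = 2 * m + 2") auto
      then show "j \<in> insert (2 * m + 1) {j::nat. j < 2 * m + 1 \<and> odd j}" using \<open>odd j\<close> by auto
    qed auto
    then show ?case using Suc by simp
  qed (simp, metis even_zero gr0I)
  moreover have "{j \<in> {..<n}. odd (\<Sum>k<j. t k j)} = {j::nat. j < 2 * m + 1 \<and> odd j}"
    using inner n by auto
  ultimately have "odd F" unfolding F_def using m by (simp add: even_sum_iff)
  have "even L"
  proof (rule ccontr)
    assume "odd L"
    then have "odd (int n * L)" using n by simp
    then show False using nL by simp
  qed
  then obtain l where l: "L = 2 * l" by (auto elim: evenE)
  then have "int n * l = F" using nL by simp
  then have "odd l" using \<open>odd F\<close> by auto
  have inner_odd: "odd (\<Sum>k<n. t i k * t k j)" if "i < n" "j < n" "i \<noteq> j" for i j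
  proof -
    have "{k \<in> {..<n}. odd (t i k * t k j)} = {..<n} - {i, j}"
      using odd_off that diag by auto
    moreover have "card ({..<n} - {i, j}) = n - 2" using that by (subst card_Diff_subset) auto
    ultimately have "even (\<Sum>k<n. t i k * t k j) \<longleftrightarrow> even (n - 2)"
      using even_sum_iff[OF finite_lessThan, of "\<lambda>k. t i k * t k j" n] by simp
    moreover have "n - 2 = 2 * (m - 1) + 1" using n m1 by simp
    ultimately show ?thesis by simp
  qed
  have "\<exists>B::int. b = of_int B"
  proof (cases "\<exists>i j k l. i < n \<and> j < n \<and> i \<noteq> j \<and> k < n \<and> l < n \<and> k \<noteq> l \<and> t i j = 1 \<and> t k l = -1")
    case True
    then obtain i j k l where a: "i < n" "j < n" "i \<noteq> j" "k < n" "l < n" "k \<noteq> l" "t i j = 1" "t k l = -1"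
      by blast
    define u where "u = (\<Sum>h<n. t i h * t h j)"
    define w where "w = (\<Sum>h<n. t k h * t h l)"
    have "real_of_int u + b = real_of_int w - b"
      using quad[OF a(1,2,3)] quad[OF a(4,5,6)] a(7,8) by (simp add: u_def w_def)
    then have b2: "2 * b = real_of_int (w - u)" by simp
    have "odd u" "odd w" using inner_odd a by (auto simp: u_def w_def)
    then have "even (w - u)" by simp
    then obtain B where "w - u = 2 * B" by (rule evenE)
    then have "b = of_int B" using b2 by simp
    then show ?thesis by blast
  next
    \<comment> \<open>All entries agree, so the column sum is \<open>2 m\<close> or \<open>-2 m\<close> and \<open>b\<close> is \<open>2\<close> or \<open>-2\<close>.\<close>
    case False
    have "\<exists>s. (s = 1 \<or> s = -1) \<and> (\<forall>k<n. k \<noteq> 0 \<longrightarrow> t k 0 = s)"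
    proof (cases "\<exists>k<n. k \<noteq> 0 \<and> t k 0 = 1")
      case True
      then have "\<forall>k<n. k \<noteq> 0 \<longrightarrow> t k 0 = 1" using False off[of _ 0] n by (metis zero_less_Suc Suc_eq_plus1)
      then show ?thesis by blast
    next
      case False
      then have "\<forall>k<n. k \<noteq> 0 \<longrightarrow> t k 0 = -1" using off[of _ 0] n by fastforce
      then show ?thesis by blast
    qed
    then obtain s where s: "s = 1 \<or> s = -1" "\<And>k. k < n \<Longrightarrow> k \<noteq> 0 \<Longrightarrow> t k 0 = s" by blast
    have "L = (\<Sum>k\<in>{..<n} - {0}. t k 0)"
      unfolding L_def using n diag[of 0] by (subst sum.remove[of _ 0]) auto
    also have "\<dots> = (\<Sum>k\<in>{..<n} - {0}. s)" using s(2) by (intro sum.cong) auto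
    also have "\<dots> = 2 * int m * s" using n by simp
    finally have "b = 2 * of_int s" using Lb m1 by simp
    then show ?thesis by (intro exI[of _ "2 * s"]) simp
  qed
  then obtain B where B: "b = of_int B" by blast
  have "real_of_int (B\<^sup>2) < real_of_int 4" using b B by simp
  then have "B\<^sup>2 < 2\<^sup>2" by (simp only: of_int_less_iff) simp
  then have "\<bar>B\<bar> < 2" using abs_le_square_iff[of 2 B] by simp
  then have "B = 0 \<or> B = 1 \<or> B = -1" by auto
  moreover have LmB: "L = int m * B"
  proof -
    have "real_of_int L = real_of_int (int m * B)" using Lb B by simp
    then show ?thesis by (simp only: of_int_eq_iff)
  qed
  moreover have "even B"
  proof -
    have "even (int m * B)" unfolding LmB[symmetric] l by simp
    then show ?thesis using m by simp
  qed
  ultimately have "L = 0" using LmB by auto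
  then show False using \<open>odd l\<close> l by simp
qed

text \<open>
  Put \<open>q x = (x - e) (x - e')\<close>. The matrix \<open>M = q(S)\<close> has the eigenvalue \<open>\<kappa> = q l\<close> once and is zero
  otherwise, so \<open>M\<^sup>2 = \<kappa> M\<close> and \<open>M S = l M\<close>. Its diagonal is constant, because \<open>S\<^sup>2\<close> has diagonal
  \<open>n - 1\<close>. Cauchy--Schwarz bounds each entry of \<open>M\<close> by the diagonal entry \<open>\<mu>\<close> in absolute value, and
  the trace of \<open>M\<^sup>2\<close> leaves no slack. So \<open>M = \<mu> z z\<^sup>T\<close> for a vector \<open>z\<close> with entries \<open>1\<close> and \<open>-1\<close>,
  and conjugating \<open>S\<close> with the diagonal matrix of \<open>z\<close> makes the all-one vector an eigenvector.
\<close>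

lemma no_seidel_matrix_with_conjugate_eigenvalues:
  fixes S :: "int mat" and e e' l :: real
  assumes S: "S \<in> carrier_mat n n" and n: "n = 2 * m + 1" and m: "odd m"
    and sym: "\<And>i j. i < n \<Longrightarrow> j < n \<Longrightarrow> S $$ (i, j) = S $$ (j, i)"
    and diag: "\<And>i. i < n \<Longrightarrow> S $$ (i, i) = 0"
    and off: "\<And>i j. i < n \<Longrightarrow> j < n \<Longrightarrow> i \<noteq> j \<Longrightarrow> S $$ (i, j) = 1 \<or> S $$ (i, j) = -1"
    and cp: "map_poly of_int (char_poly S) = ([:- e, 1:] * [:- e', 1:]) ^ m * [:- l, 1:]"
    and ne: "e \<noteq> e'" "l \<noteq> e" "l \<noteq> e'"
  shows False
proof -
  define A where "A = map_mat real_of_int S"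
  have A: "A \<in> carrier_mat n n" using S by (simp add: A_def)
  have Aij: "A $$ (i, j) = real_of_int (S $$ (i, j))" if "i < n" "j < n" for i j
    using that S by (simp add: A_def)
  have At: "transpose_mat A = A"
    by (rule eq_matI) (use A sym in \<open>auto simp: Aij\<close>)
  \<comment> \<open>the eigenvalues of \<open>S\<close>\<close>
  define es where "es = replicate m e @ replicate m e' @ [l]"
  have les: "length es = n" by (simp add: es_def n)
  have cpA: "char_poly A = (\<Prod>x\<leftarrow>es. [:- x, 1:])"
  proof -
    have "char_poly A = map_poly of_int (char_poly S)"
      unfolding A_def using of_int_hom.char_poly_hom[OF S] by simp
    also have "\<dots> = [:- e, 1:] ^ m * [:- e', 1:] ^ m * [:- l, 1:]"
      unfolding cp by (simp only: power_mult_distrib)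
    also have "\<dots> = (\<Prod>x\<leftarrow>es. [:- x, 1:])"
      unfolding es_def
      by (simp only: map_append prod_list.append map_replicate prod_list_replicate list.map
        prod_list.Cons prod_list.Nil mult_1_right mult.assoc)
    finally show ?thesis .
  qed
  obtain T P Q where "schur_decomposition A es = (T, P, Q)" by (cases "schur_decomposition A es") auto
  from schur_decomposition[OF A cpA this]
  have wit: "similar_mat_wit A T P Q" and T: "upper_triangular T" "diag_mat T = es" by auto
  note W = similar_mat_witD2[OF A wit]
  note tz = W(6) W(7) W(1) W(2)
  note tri_def = triangularized_def[OF tz] and tri_mult = triangularized_mult[OF tz]
    and tri_add = triangularized_add[OF tz] and tri_smult = triangularized_smult[OF tz]
    and tri_one = triangularized_one[OF tz] and tri_tr = tr_triangularized[OF tz]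
    and tri_0 = symmetric_nilpotent_eq_0[OF tz]
  let ?tri = "triangularized P Q n"
  have QAP: "Q * A * P = T"
  proof -
    have "Q * A * P = Q * (P * T * Q) * P" using W(3) by simp
    also have "\<dots> = (Q * P) * T * (Q * P)"
      using W(5-7) by (simp add: assoc_mult_mat[of _ n n _ n _ n])
    finally show ?thesis using W(2,5) by simp
  qed
  have triA: "?tri A (\<lambda>i. es ! i)"
  proof -
    have "T $$ (i, i) = es ! i" if "i < n" for i
      using that W(5) unfolding T(2)[symmetric] diag_mat_def by simp
    then show ?thesis using T(1) W(5) A unfolding tri_def QAP by (auto simp: upper_triangular_def)
  qed
  have sum_es: "(\<Sum>i<n. f (es ! i)) = real m * f e + real m * f e' + f l" for f :: "real \<Rightarrow> real"
  proof -
    have "(\<Sum>i<n. f (es ! i)) = sum_list (map f es)"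
      using les by (simp add: sum_list_sum_nth atLeast0LessThan)
    then show ?thesis by (simp add: es_def sum_list_replicate map_replicate)
  qed
  have AAii: "(A * A) $$ (i, i) = 2 * real m" if i: "i < n" for i
  proof -
    have "(A * A) $$ (i, i) = (\<Sum>k<n. A $$ (i, k) * A $$ (k, i))"
      using mult_index_sum[OF A A i i] .
    also have "\<dots> = (\<Sum>k<n. if k = i then 0 else 1)"
    proof (intro sum.cong refl)
      fix k assume "k \<in> {..<n}"
      then show "A $$ (i, k) * A $$ (k, i) = (if k = i then 0 else 1)"
        using i off[of i k] sym[of i k] diag[of i] by (auto simp: Aij)
    qed
    also have "\<dots> = (\<Sum>k\<in>{..<n} - {i}. 1)" by (intro sum.mono_neutral_cong_right) auto
    finally show ?thesis using i n by simp
  qed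
  define b c where "b = - (e + e')" and "c = e * e'"
  have tr1: "l = real m * b"
  proof -
    have "0 = (\<Sum>i<n. A $$ (i, i))" using diag by (simp add: Aij)
    also have "\<dots> = tr A" using A by (simp add: tr_def)
    also have "\<dots> = real m * e + real m * e' + l" using tri_tr[OF triA] sum_es[of "\<lambda>x. x"] by simp
    finally show ?thesis by (simp add: b_def algebra_simps)
  qed
  have tr2: "real n * (2 * real m) = real m * (e * e) + real m * (e' * e') + l * l"
  proof -
    have "real n * (2 * real m) = (\<Sum>i<n. (A * A) $$ (i, i))" using AAii by simp
    also have "\<dots> = tr (A * A)" using A by (simp add: tr_def)
    also have "\<dots> = real m * (e * e) + real m * (e' * e') + l * l"
      using tri_tr[OF tri_mult[OF triA triA]] sum_es[of "\<lambda>x. x * x"] by simp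
    finally show ?thesis .
  qed
  have m1: "m \<ge> 1" using m by (cases m) auto
  \<comment> \<open>\<open>n (4 - b\<^sup>2)\<close> is the square of \<open>e - e'\<close>.\<close>
  have b4: "b\<^sup>2 < 4"
  proof -
    have "e * e + e' * e' = 2 * real n - real m * b\<^sup>2"
    proof -
      have "real m * (e * e + e' * e') = real m * (2 * real n - real m * b\<^sup>2)"
        using tr2 unfolding tr1 by (simp add: algebra_simps power2_eq_square)
      then show ?thesis using m1 by simp
    qed
    moreover have "(e - e')\<^sup>2 > 0" using ne(1) by simp
    moreover have "(e - e')\<^sup>2 = 2 * (e * e + e' * e') - b\<^sup>2"
      by (simp add: b_def power2_eq_square algebra_simps)
    ultimately have "0 < real n * (4 - b\<^sup>2)" by (simp add: n algebra_simps)
    then show ?thesis by (simp add: zero_less_mult_iff)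
  qed
  define M where "M = A * A + (b \<cdot>\<^sub>m A + c \<cdot>\<^sub>m 1\<^sub>m n)"
  define q where "q x = x * x + (b * x + c * 1)" for x
  have q: "q x = (x - e) * (x - e')" for x by (simp add: q_def b_def c_def algebra_simps)
  have triM: "?tri M (\<lambda>i. q (es ! i))"
    unfolding M_def q_def by (intro tri_add tri_mult tri_smult tri_one triA)
  define \<kappa> where "\<kappa> = q l"
  have \<kappa>0: "\<kappa> \<noteq> 0" using ne by (simp add: \<kappa>_def q)
  have qes: "q (es ! i) = 0 \<or> es ! i = l" if "i < n" for i
  proof -
    have "es ! i \<in> set es" using that les by simp
    then show ?thesis by (auto simp: es_def q)
  qed
  have M: "M \<in> carrier_mat n n" using A by (simp add: M_def)
  have Mt: "transpose_mat M = M"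
  proof -
    have "transpose_mat (A * A) = A * A" using transpose_mult[OF A A] At by simp
    moreover have "transpose_mat (b \<cdot>\<^sub>m A) = b \<cdot>\<^sub>m A" using At by (metis transpose_smult_mat)
    moreover have "transpose_mat (c \<cdot>\<^sub>m 1\<^sub>m n) = c \<cdot>\<^sub>m 1\<^sub>m n" by (rule eq_matI) auto
    ultimately show ?thesis unfolding M_def using A by (simp add: transpose_add[of _ n n])
  qed
  have MA: "M * A = A * M"
    unfolding M_def using A
    by (simp add: add_mult_distrib_mat[of _ n n _ _ n] mult_add_distrib_mat[of _ n n _ n]
        mult_smult_distrib[of _ n n _ n] mult_smult_assoc_mat[of _ n n _ n] assoc_mult_mat[of _ n n _ n _ n])
  have Msym: "M $$ (i, j) = M $$ (j, i)" if "i < n" "j < n" for i j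
    using that M Mt index_transpose_mat(1)[of i M j] by auto
  have MM: "(M * M) $$ (i, j) = \<kappa> * M $$ (i, j)" if ij: "i < n" "j < n" for i j
  proof -
    have "?tri (M * M + (- \<kappa>) \<cdot>\<^sub>m M) (\<lambda>i. q (es ! i) * q (es ! i) + (- \<kappa>) * q (es ! i))"
      by (intro tri_add tri_mult tri_smult triM)
    then have "?tri (M * M + (- \<kappa>) \<cdot>\<^sub>m M) (\<lambda>i. 0)"
      unfolding tri_def using qes by (auto simp: \<kappa>_def simp del: index_mult_mat)
    moreover have "transpose_mat (M * M + (- \<kappa>) \<cdot>\<^sub>m M) = M * M + (- \<kappa>) \<cdot>\<^sub>m M"
      using M Mt transpose_mult[OF M M] by (simp add: transpose_add[of _ n n] transpose_smult_mat)
    ultimately have "(M * M + (- \<kappa>) \<cdot>\<^sub>m M) $$ (i, j) = 0" using tri_0 ij by blast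
    then show ?thesis using M ij by (simp del: index_mult_mat(1))
  qed
  have MAl: "(M * A) $$ (i, j) = l * M $$ (i, j)" if ij: "i < n" "j < n" for i j
  proof -
    have "?tri (M * A + (- l) \<cdot>\<^sub>m M) (\<lambda>i. q (es ! i) * es ! i + (- l) * q (es ! i))"
      by (intro tri_add tri_mult tri_smult triM triA)
    then have "?tri (M * A + (- l) \<cdot>\<^sub>m M) (\<lambda>i. 0)"
      unfolding tri_def using qes by (auto simp del: index_mult_mat)
    moreover have "transpose_mat (M * A + (- l) \<cdot>\<^sub>m M) = M * A + (- l) \<cdot>\<^sub>m M"
      using M A Mt At transpose_mult[OF M A] MA by (simp add: transpose_add[of _ n n] transpose_smult_mat)
    ultimately have "(M * A + (- l) \<cdot>\<^sub>m M) $$ (i, j) = 0" using tri_0 ij by blast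
    then show ?thesis using M A ij by (simp del: index_mult_mat(1))
  qed
  have Mij: "M $$ (i, j) = (\<Sum>k<n. A $$ (i, k) * A $$ (k, j)) + b * A $$ (i, j) + (if i = j then c else 0)"
    if ij: "i < n" "j < n" for i j
    unfolding M_def using A ij mult_index_sum[OF A A ij] by (simp del: index_mult_mat(1))
  define \<mu> where "\<mu> = 2 * real m + c"
  have Mii: "M $$ (i, i) = \<mu>" if "i < n" for i
    using Mij[OF that that] AAii[OF that] mult_index_sum[OF A A that that] diag[OF that] Aij[OF that that]
    by (simp add: \<mu>_def)
  have \<kappa>\<mu>: "\<kappa> = real n * \<mu>"
  proof -
    have "real n * \<mu> = (\<Sum>i<n. M $$ (i, i))" using Mii by simp
    also have "\<dots> = tr M" using M by (simp add: tr_def)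
    also have "\<dots> = \<kappa>" using tri_tr[OF triM] sum_es[of q] by (simp add: q \<kappa>_def)
    finally show ?thesis ..
  qed
  have \<mu>0: "\<mu> \<noteq> 0" using \<kappa>0 \<kappa>\<mu> by auto
  have n0: "real n > 0" using n by simp
  \<comment> \<open>the entries of \<open>M\<close> relative to the diagonal; they turn out to be \<open>1\<close> or \<open>-1\<close>\<close>
  define v where "v i j = M $$ (i, j) / \<mu>" for i j
  have vv: "(\<Sum>k<n. v i k * v k j) = real n * v i j" if ij: "i < n" "j < n" for i j
  proof -
    have "(\<Sum>k<n. M $$ (i, k) * M $$ (k, j)) = real n * \<mu> * M $$ (i, j)"
      using MM[OF ij] mult_index_sum[OF M M ij] \<kappa>\<mu> by simp
    moreover have "(\<Sum>k<n. v i k * v k j) = (\<Sum>k<n. M $$ (i, k) * M $$ (k, j)) / (\<mu> * \<mu>)"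
      by (simp add: v_def sum_divide_distrib)
    ultimately show ?thesis using \<mu>0 by (simp add: v_def)
  qed
  have vsym: "v i j = v j i" if "i < n" "j < n" for i j using Msym[OF that] by (simp add: v_def)
  have vii: "v i i = 1" if "i < n" for i using Mii[OF that] \<mu>0 by (simp add: v_def)
  have vsq: "(\<Sum>k<n. (v i k)\<^sup>2) = real n" if i: "i < n" for i
  proof -
    have "(\<Sum>k<n. (v i k)\<^sup>2) = (\<Sum>k<n. v i k * v k i)"
      by (intro sum.cong refl) (simp add: power2_eq_square vsym[OF i])
    then show ?thesis using vv[OF i i] vii[OF i] by simp
  qed
  have vle: "(v i j)\<^sup>2 \<le> 1" if ij: "i < n" "j < n" for i j
  proof -
    have "(real n * v i j)\<^sup>2 = (\<Sum>k<n. v i k * v j k)\<^sup>2"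
    proof -
      have "(\<Sum>k<n. v i k * v k j) = (\<Sum>k<n. v i k * v j k)"
        by (intro sum.cong refl) (simp add: vsym[OF _ ij(2)])
      then show ?thesis using vv[OF ij] by simp
    qed
    also have "\<dots> \<le> (\<Sum>k<n. (v i k)\<^sup>2) * (\<Sum>k<n. (v j k)\<^sup>2)"
      by (rule Cauchy_Schwarz_ineq_sum)
    also have "\<dots> = (real n)\<^sup>2" using vsq ij by (simp add: power2_eq_square)
    finally have "(real n)\<^sup>2 * (v i j)\<^sup>2 \<le> (real n)\<^sup>2 * 1" by (simp add: power_mult_distrib)
    then show ?thesis using n0 by (subst (asm) mult_le_cancel_left_pos) auto
  qed
  have v1: "v i j = 1 \<or> v i j = -1" if ij: "i < n" "j < n" for i j
  proof -
    have "(\<Sum>k<n. 1 - (v i k)\<^sup>2) = 0" using vsq[OF ij(1)] by (simp add: sum_subtractf)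
    then have "1 - (v i j)\<^sup>2 = 0"
      using vle[OF ij(1)] ij(2) by (subst (asm) sum_nonneg_eq_0_iff) auto
    then show ?thesis by (simp add: power2_eq_1_iff)
  qed
  have vmul: "v i k * v k j = v i j" if ijk: "i < n" "j < n" "k < n" for i j k
  proof -
    have "(\<Sum>k<n. 1 - v i j * (v i k * v k j)) = real n - v i j * (\<Sum>k<n. v i k * v k j)"
      by (simp add: sum_subtractf sum_distrib_left)
    also have "\<dots> = 0" using vv[OF ijk(1,2)] v1[OF ijk(1,2)] by auto
    finally have s: "(\<Sum>k<n. 1 - v i j * (v i k * v k j)) = 0" .
    have "0 \<le> 1 - v i j * (v i h * v h j)" if "h < n" for h
      using v1[OF ijk(1,2)] v1[OF ijk(1) that] v1[OF that ijk(2)] by auto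
    then have "1 - v i j * (v i k * v k j) = 0"
      using s ijk(3) by (subst (asm) sum_nonneg_eq_0_iff) auto
    then show ?thesis using v1[OF ijk(1,2)] by auto
  qed
  define z :: "nat \<Rightarrow> int" where "z i = (if v 0 i = 1 then 1 else -1)" for i
  have n1: "0 < n" using n by simp
  have z: "real_of_int (z i) = v 0 i" if "i < n" for i
    using v1[OF n1 that] by (auto simp: z_def)
  have zz: "real_of_int (z i * z j) = v i j" if "i < n" "j < n" for i j
    using vmul[OF that(1) that(2) n1] z[OF that(1)] z[OF that(2)] vsym[OF that(1) n1] by simp
  have z1: "z i = 1 \<or> z i = -1" for i by (simp add: z_def)
  \<comment> \<open>the conjugate of \<open>S\<close> by the diagonal matrix of \<open>z\<close>\<close>
  define t where "t i j = z i * S $$ (i, j) * z j" for i j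
  show False
  proof (rule no_sign_matrix_with_constant_column_sums[OF n m _ _ _ _ _ b4, of t \<mu>])
    fix i j assume ij: "i < n" "j < n"
    show "t i j = t j i" using sym[OF ij] by (simp add: t_def)
  next
    fix i assume "i < n" then show "t i i = 0" using diag by (simp add: t_def)
  next
    fix i j assume ij: "i < n" "j < n" "i \<noteq> j"
    show "t i j = 1 \<or> t i j = -1" using off[OF ij] z1[of i] z1[of j] by (auto simp: t_def)
    have "real_of_int (\<Sum>k<n. t i k * t k j) = v i j * (\<Sum>k<n. A $$ (i, k) * A $$ (k, j))"
    proof -
      have "t i k * t k j = (z i * z j) * (S $$ (i, k) * S $$ (k, j))" for k
        using z1[of k] by (auto simp: t_def)
      then have "(\<Sum>k<n. t i k * t k j) = (z i * z j) * (\<Sum>k<n. S $$ (i, k) * S $$ (k, j))"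
        by (simp add: sum_distrib_left)
      then have "real_of_int (\<Sum>k<n. t i k * t k j) = real_of_int (z i * z j) * real_of_int (\<Sum>k<n. S $$ (i, k) * S $$ (k, j))"
        by (simp only: of_int_mult)
      moreover have "real_of_int (\<Sum>k<n. S $$ (i, k) * S $$ (k, j)) = (\<Sum>k<n. A $$ (i, k) * A $$ (k, j))"
        using ij by (simp add: Aij)
      ultimately show ?thesis using zz[OF ij(1,2)] by simp
    qed
    moreover have "real_of_int (t i j) = v i j * A $$ (i, j)"
      using zz[OF ij(1,2)] ij by (simp add: t_def Aij mult.assoc mult.commute)
    ultimately have "real_of_int (\<Sum>k<n. t i k * t k j) + b * real_of_int (t i j) = v i j * M $$ (i, j)"
      using Mij[OF ij(1,2)] ij(3) by (simp add: algebra_simps)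
    also have "\<dots> = \<mu>" using v1[OF ij(1,2)] \<mu>0 by (auto simp: v_def field_simps)
    finally show "real_of_int (\<Sum>k<n. t i k * t k j) + b * real_of_int (t i j) = \<mu>" .
  next
    fix j assume j: "j < n"
    have "(\<Sum>k<n. M $$ (0, k) * A $$ (k, j)) = l * M $$ (0, j)"
      using MAl[OF n1 j] mult_index_sum[OF M A n1 j] by simp
    then have "(\<Sum>k<n. v 0 k * A $$ (k, j)) = l * v 0 j"
      by (simp add: v_def sum_divide_distrib[symmetric])
    moreover have "real_of_int (\<Sum>k<n. t k j) = (\<Sum>k<n. v 0 k * A $$ (k, j)) * v 0 j"
      using j by (simp add: t_def sum_distrib_right z Aij)
    ultimately show "real_of_int (\<Sum>k<n. t k j) = real m * b"
      using v1[OF n1 j] tr1 by auto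
  qed
qed

section \<open>The angle of a large set\<close>

text \<open>
  With a basis in front, the linear relations among the vectors are the last columns of a
  unitriangular matrix.
\<close>

lemma spanning_enumeration:
  fixes X :: "'a::euclidean_space set"
  assumes fin: "finite X" and r: "dim X = r" "r \<le> n" "n \<le> card X"
  obtains x :: "nat \<Rightarrow> 'a" and c :: "nat \<Rightarrow> nat \<Rightarrow> real"
  where "inj_on x {..<n}" "x ` {..<n} \<subseteq> X" "dim (x ` {..<n}) = r"
    "\<And>j. r \<le> j \<Longrightarrow> j < n \<Longrightarrow> x j = (\<Sum>k<r. c j k *\<^sub>R x k)"
proof -
  obtain B where B: "B \<subseteq> X" "independent B" "X \<subseteq> span B" "card B = r"
    using basis_exists[of X] r(1) by metis
  have fB: "finite B" using B(1) fin by (rule finite_subset)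
  have "n - r \<le> card (X - B)" using B(1,4) fB r by (simp add: card_Diff_subset)
  then obtain C where C: "C \<subseteq> X - B" "card C = n - r" "finite C"
    using obtain_subset_with_card_n by metis
  obtain f where f: "bij_betw f {..<r} B"
    using ex_bij_betw_nat_finite[OF fB] B(4) by (auto simp: atLeast0LessThan)
  obtain g where g: "bij_betw g {..<n - r} C"
    using ex_bij_betw_nat_finite[OF C(3)] C(2) by (auto simp: atLeast0LessThan)
  define x where "x i = (if i < r then f i else g (i - r))" for i
  have fim: "f ` {..<r} = B" "inj_on f {..<r}" and gim: "g ` {..<n - r} = C" "inj_on g {..<n - r}"
    using f g by (auto simp: bij_betw_def)
  have xB: "x ` {..<r} = B" using fim(1) by (simp add: x_def)
  have xC: "x i \<in> C" if "r \<le> i" "i < n" for i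
  proof -
    have "i - r \<in> {..<n - r}" using that by auto
    then show ?thesis using that gim(1) by (auto simp: x_def)
  qed
  have xinB: "x i \<in> B" if "i < r" for i using xB that by blast
  have xX: "x ` {..<n} \<subseteq> X"
  proof
    fix y assume "y \<in> x ` {..<n}"
    then obtain i where "i < n" "y = x i" by auto
    then show "y \<in> X" using xinB[of i] xC[of i] B(1) C(1) by (cases "i < r") auto
  qed
  have inj: "inj_on x {..<n}"
  proof (rule inj_onI)
    fix i j assume ij: "i \<in> {..<n}" "j \<in> {..<n}" "x i = x j"
    have "i < r \<longleftrightarrow> j < r"
      using ij xinB[of i] xinB[of j] xC[of i] xC[of j] C(1) by (metis DiffD2 lessThan_iff not_le subsetD)
    then consider "i < r" "j < r" | "r \<le> i" "r \<le> j" by linarith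
    then show "i = j"
    proof cases
      case 1
      then show ?thesis using ij fim(2) by (auto simp: x_def inj_on_def)
    next
      case 2
      then have "i - r = j - r"
        using ij inj_onD[OF gim(2), of "i - r" "j - r"] by (auto simp: x_def)
      then show ?thesis using 2 by simp
    qed
  qed
  have "B \<subseteq> x ` {..<n}"
  proof -
    have "x ` {..<r} \<subseteq> x ` {..<n}" using r(2) by (intro image_mono) auto
    then show ?thesis using xB by simp
  qed
  then have "r \<le> dim (x ` {..<n})" using dim_subset B(2,4) by (metis dim_eq_card_independent)
  then have dimx: "dim (x ` {..<n}) = r" using dim_subset[OF xX] r(1) by simp
  have "\<exists>u. x j = (\<Sum>k<r. u k *\<^sub>R x k)" if "r \<le> j" "j < n" for j
  proof -
    have "x j \<in> span B" using xX B(3) that by auto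
    then obtain u where u: "x j = (\<Sum>v\<in>B. u v *\<^sub>R v)" using span_finite[OF fB] by auto
    have injr: "inj_on x {..<r}" by (rule inj_on_subset[OF inj]) (use r(2) in auto)
    have "x j = (\<Sum>k<r. u (x k) *\<^sub>R x k)"
      unfolding u xB[symmetric] by (simp add: sum.reindex[OF injr])
    then show ?thesis by (rule exI[of _ "\<lambda>k. u (x k)"])
  qed
  then have "\<forall>j. \<exists>u. r \<le> j \<and> j < n \<longrightarrow> x j = (\<Sum>k<r. u k *\<^sub>R x k)" by blast
  then obtain c where "\<forall>j. r \<le> j \<and> j < n \<longrightarrow> x j = (\<Sum>k<r. c j k *\<^sub>R x k)"
    unfolding choice_iff by blast
  then show ?thesis using that[OF inj xX dimx] by blast
qed

text \<open>
  The hypotheses on \<open>r\<close> and \<open>m\<close> are those that the argument meets with \<open>n = r + m\<close> vectors: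
  \<open>r < 2 m\<close> says \<open>n < 3 m\<close> and limits the degree of the eigenvalue \<open>-a\<close>; \<open>shape\<close> makes a quadratic
  eigenvalue impossible, either by parity or because \<open>n < 2 m\<close>; \<open>bound\<close> gives \<open>a < 5\<close> by the
  relative bound; and \<open>2 \<le> m\<close> leaves room for an even number of vectors that exceeds the rank.
\<close>

lemma equiangular_angle_eq_third:
  fixes X :: "'a::euclidean_space set"
  assumes eq: "equiangular X" and r: "dim X = r" and nX: "r + m \<le> card X"
    and m: "2 \<le> m" and shape: "odd m \<and> r = m + 1 \<or> r < m"
    and n3: "r < 2 * m" and bound: "r * (r + m - 1) < 25 * m"
    and xy: "y \<in> X" "y' \<in> X" "y \<noteq> y'"
  shows "y \<bullet> y' \<in> {1/3, -1/3}"
proof -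
  define n where "n = r + m"
  obtain \<alpha> where fin: "finite X" and un: "\<And>x. x \<in> X \<Longrightarrow> norm x = 1"
    and \<alpha>: "0 \<le> \<alpha>" "\<alpha> < 1"
    and ip: "\<And>x y. x \<in> X \<Longrightarrow> y \<in> X \<Longrightarrow> x \<noteq> y \<Longrightarrow> x \<bullet> y \<in> {-\<alpha>, \<alpha>}"
    using eq unfolding equiangular_def by blast
  have \<alpha>0: "\<alpha> \<noteq> 0"
  proof
    assume "\<alpha> = 0"
    then have "pairwise orthogonal X" using ip by (auto simp: pairwise_def orthogonal_def)
    moreover have "0 \<notin> X" using un by force
    ultimately have "independent X" by (rule pairwise_orthogonal_independent)
    then have "card X = r" using r by (simp add: dim_eq_card_independent)
    then show False using nX m by simp
  qed
  define a where "a = 1 / \<alpha>"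
  have a: "a > 1" "\<alpha> * a = 1" using \<alpha> \<alpha>0 by (simp_all add: a_def)
  have n: "r \<le> n" "n \<le> card X" using nX by (simp_all add: n_def)
  obtain x c where inj: "inj_on x {..<n}" and xX: "x ` {..<n} \<subseteq> X" and dimx: "dim (x ` {..<n}) = r"
    and c: "\<And>j. r \<le> j \<Longrightarrow> j < n \<Longrightarrow> x j = (\<Sum>k<r. c j k *\<^sub>R x k)"
    using spanning_enumeration[OF fin r n] by blast
  have xin: "x i \<in> X" if "i < n" for i using xX that by auto
  \<comment> \<open>the Seidel matrix\<close>
  define s :: "nat \<Rightarrow> nat \<Rightarrow> int" where "s i j = (if i = j then 0 else if x i \<bullet> x j > 0 then 1 else -1)" for i j
  have xx: "a * (x i \<bullet> x j) = (if i = j then a else 0) + real_of_int (s i j)" if "i < n" "j < n" for i j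
  proof (cases "i = j")
    case True
    have "x i \<bullet> x i = 1" using un[OF xin[OF that(1)]] by (simp add: norm_eq_1)
    then show ?thesis using True by (simp add: s_def)
  next
    case False
    then have "x i \<noteq> x j" using inj that by (auto simp: inj_on_def)
    then have "x i \<bullet> x j = - \<alpha> \<or> x i \<bullet> x j = \<alpha>" using ip[of "x i" "x j"] xin that by auto
    then show ?thesis using False a \<alpha> \<alpha>0 by (auto simp: s_def mult.commute)
  qed
  have ssym: "s i j = s j i" for i j by (simp add: s_def inner_commute)
  have soff: "s i j = 1 \<or> s i j = -1" if "i \<noteq> j" for i j using that by (simp add: s_def)
  define S where "S = mat n n (\<lambda>(i, j). s i j)"
  have S: "S \<in> carrier_mat n n" by (simp add: S_def)
  \<comment> \<open>The columns from \<open>r\<close> on are the linear relations among the vectors.\<close>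
  define U where "U = mat n n (\<lambda>(k, j). if k = j then 1 else if k < r \<and> r \<le> j then - c j k else (0::real))"
  have U: "U \<in> carrier_mat n n" by (simp add: U_def)
  have Ucol: "(\<Sum>k<n. real_of_int (s i k) * U $$ (k, j)) = (- a) * U $$ (i, j)"
    if ij: "i < n" "r \<le> j" "j < n" for i j
  proof -
    have rn: "r \<le> n" by (simp add: n_def)
    have "(\<Sum>k<n. U $$ (k, j) *\<^sub>R x k) = (\<Sum>k<n. (if k = j then x j else 0) + (if k < r then - (c j k *\<^sub>R x k) else 0))"
      using ij by (intro sum.cong refl) (auto simp: U_def)
    also have "\<dots> = x j + (\<Sum>k<n. if k < r then - (c j k *\<^sub>R x k) else 0)"
      using ij by (simp add: sum.distrib)
    also have "(\<Sum>k<n. if k < r then - (c j k *\<^sub>R x k) else 0) = (\<Sum>k<r. - (c j k *\<^sub>R x k))"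
      using rn by (intro sum.mono_neutral_cong_right) auto
    also have "x j + \<dots> = 0" using c[OF ij(2,3)] by (simp add: sum_negf)
    finally have z: "(\<Sum>k<n. U $$ (k, j) *\<^sub>R x k) = 0" .
    have "(\<Sum>k<n. real_of_int (s i k) * U $$ (k, j)) =
      (\<Sum>k<n. a * (x i \<bullet> (U $$ (k, j) *\<^sub>R x k)) + (if k = i then - a * U $$ (i, j) else 0))"
    proof (intro sum.cong refl)
      fix k assume "k \<in> {..<n}"
      then have e: "real_of_int (s i k) = a * (x i \<bullet> x k) - (if i = k then a else 0)"
        using xx[of i k] ij(1) by simp
      show "real_of_int (s i k) * U $$ (k, j) =
        a * (x i \<bullet> (U $$ (k, j) *\<^sub>R x k)) + (if k = i then - a * U $$ (i, j) else 0)"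
        unfolding e inner_scaleR_right by (auto simp: algebra_simps)
    qed
    also have "\<dots> = a * (x i \<bullet> (\<Sum>k<n. U $$ (k, j) *\<^sub>R x k)) + (- a) * U $$ (i, j)"
      using ij(1) by (simp add: sum.distrib inner_sum_right sum_distrib_left)
    finally show ?thesis by (simp add: z)
  qed
  have "[:- (- a), 1:] ^ (n - r) dvd char_poly (map_mat real_of_int S)"
  proof (rule char_poly_dvd_if_eigenvector_columns[OF _ U])
    fix i j assume ij: "i < n" "r \<le> j" "j < n"
    have "(\<Sum>k<n. map_mat real_of_int S $$ (i, k) * U $$ (k, j)) = (\<Sum>k<n. real_of_int (s i k) * U $$ (k, j))"
      using ij by (intro sum.cong refl) (simp add: S_def)
    then show "(\<Sum>k<n. map_mat real_of_int S $$ (i, k) * U $$ (k, j)) = - a * U $$ (i, j)"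
      using Ucol[OF ij] by simp
  qed (use S in \<open>auto simp: U_def upper_triangular_def n_def\<close>)
  moreover have "char_poly (map_mat real_of_int S) = map_poly real_of_int (char_poly S)"
    by (rule of_int_hom.char_poly_hom[OF S])
  ultimately have dvd: "[:- (- a), 1:] ^ m dvd map_poly real_of_int (char_poly S)"
    unfolding n_def by (simp only: diff_add_inverse)
  have monic: "monic (char_poly S)" "degree (char_poly S) = n"
    using degree_monic_char_poly[OF S] by auto
  have "- a \<in> \<int>"
  proof (rule ccontr)
    assume "- a \<notin> \<int>"
    then obtain e' q where irr: "- a \<notin> \<rat>" and nm: "2 * m \<le> n" and e': "- a + e' \<in> \<rat>"
      and q: "map_poly real_of_int (char_poly S) = ([:- (- a), 1:] * [:- e', 1:]) ^ m * map_poly of_rat q"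
      using multiple_root_of_monic_int_poly[OF monic dvd] m n3 by (auto simp: n_def)
    have odd: "odd m" "n = 2 * m + 1" using nm shape by (auto simp: n_def)
    have "map_poly real_of_int (char_poly S) \<noteq> 0" using monic(1) by auto
    then have "map_poly (of_rat :: rat \<Rightarrow> real) q \<noteq> 0" using q by auto
    then have "n = 2 * m + degree q"
      using arg_cong[OF q, of degree] monic(2) by (simp add: degree_mult_eq degree_power_eq)
    then have dq: "degree q = 1" using odd by simp
    have "lead_coeff (map_poly real_of_int (char_poly S)) = 1" using monic(1) by simp
    then have "lead_coeff (map_poly (of_rat :: rat \<Rightarrow> real) q) = 1"
      unfolding q by (simp only: lead_coeff_mult lead_coeff_power) simp
    then have "coeff q 1 = 1" using dq by simp
    moreover obtain b0 c0 where "q = [:c0, b0:]" using degree1_coeffs[OF dq] by metis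
    ultimately have "q = [:c0, 1:]" by simp
    then have ql: "map_poly of_rat q = [:- (- real_of_rat c0), 1:]" by simp
    show False
    proof (rule no_seidel_matrix_with_conjugate_eigenvalues[OF S odd(2,1)])
      show "map_poly real_of_int (char_poly S) = ([:- (- a), 1:] * [:- e', 1:]) ^ m * [:- (- real_of_rat c0), 1:]"
        using q unfolding ql .
      show "- a \<noteq> e'"
      proof
        assume "- a = e'"
        then have "- a = (- a + e') / 2" by simp
        then show False using e' irr by (metis Rats_divide Rats_number_of)
      qed
      show "- real_of_rat c0 \<noteq> - a" using irr by (metis Rats_minus_iff Rats_of_rat)
      show "- real_of_rat c0 \<noteq> e'"
      proof
        assume "- real_of_rat c0 = e'"
        then have "- a = (- a + e') + real_of_rat c0" by simp
        then show False using e' irr by (metis Rats_add Rats_of_rat)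
      qed
    qed (use ssym soff in \<open>auto simp: S_def\<close>, auto simp: s_def)
  qed
  then have "a \<in> \<int>" by simp
  then obtain A where A: "a = of_int A" by (auto elim: Ints_cases)
  have a5: "a < 5"
  proof -
    let ?Y = "x ` {..<n}"
    have cY: "card ?Y = n" using card_image[OF inj] by simp
    have "(\<Sum>y\<in>?Y. \<Sum>y'\<in>?Y. (y \<bullet> y')\<^sup>2) = (\<Sum>i<n. \<Sum>j<n. (x i \<bullet> x j)\<^sup>2)"
      by (simp add: sum.reindex[OF inj])
    also have "\<dots> = (\<Sum>i<n. \<Sum>j<n. \<alpha>\<^sup>2 + (if j = i then 1 - \<alpha>\<^sup>2 else 0))"
    proof (intro sum.cong refl)
      fix i j assume "i \<in> {..<n}" "j \<in> {..<n}"
      then have ij: "i < n" "j < n" by auto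
      show "(x i \<bullet> x j)\<^sup>2 = \<alpha>\<^sup>2 + (if j = i then 1 - \<alpha>\<^sup>2 else 0)"
      proof (cases "j = i")
        case True
        have "x i \<bullet> x i = 1" using un[OF xin[OF ij(1)]] by (simp add: norm_eq_1)
        then show ?thesis using True by simp
      next
        case False
        then have "x i \<noteq> x j" using inj ij by (auto simp: inj_on_def)
        then have "x i \<bullet> x j = - \<alpha> \<or> x i \<bullet> x j = \<alpha>" using ip[of "x i" "x j"] xin ij by auto
        then show ?thesis using False by auto
      qed
    qed
    also have "\<dots> = real n * (real n * \<alpha>\<^sup>2 + (1 - \<alpha>\<^sup>2))"
      by (simp add: sum.distrib)
    finally have sm: "(\<Sum>y\<in>?Y. \<Sum>y'\<in>?Y. (y \<bullet> y')\<^sup>2) = real n * (real n * \<alpha>\<^sup>2 + (1 - \<alpha>\<^sup>2))" .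
    have "(real n)\<^sup>2 \<le> real r * (real n * (real n * \<alpha>\<^sup>2 + (1 - \<alpha>\<^sup>2)))"
      using card_power2_le_dim_sum_inner[of ?Y] un xX unfolding sm cY dimx by auto
    then have "real n * real n \<le> real n * (real r * (real n * \<alpha>\<^sup>2 + (1 - \<alpha>\<^sup>2)))"
      by (simp add: power2_eq_square algebra_simps)
    moreover have "0 < real n" using m by (simp add: n_def)
    ultimately have le: "real n \<le> real r * (real n * \<alpha>\<^sup>2 + (1 - \<alpha>\<^sup>2))"
      by (simp only: mult_le_cancel_left_pos)
    then have "a\<^sup>2 * real n \<le> a\<^sup>2 * (real r * (real n * \<alpha>\<^sup>2 + (1 - \<alpha>\<^sup>2)))"
      by (intro mult_left_mono) auto
    also have "\<dots> = real r * (real n * (\<alpha> * a)\<^sup>2 + (a\<^sup>2 - (\<alpha> * a)\<^sup>2))"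
      by (simp add: power_mult_distrib algebra_simps)
    also have "\<dots> = real r * (real n + a\<^sup>2 - 1)" by (simp add: a)
    finally have "a\<^sup>2 * real m \<le> real r * (real n - 1)" by (simp add: n_def algebra_simps)
    also have "real r * (real n - 1) = real (r * (r + m - 1))" using m by (simp add: n_def of_nat_diff)
    also have "\<dots> < real (25 * m)" using bound by (simp only: of_nat_less_iff)
    also have "\<dots> = 5\<^sup>2 * real m" by simp
    finally have "a\<^sup>2 < 5\<^sup>2" using m by (simp only: mult_less_cancel_right_pos of_nat_0_less_iff)
    then show ?thesis by (rule power_less_imp_less_base) simp
  qed
  have "odd A"
  proof
    assume ev: "even A"
    \<comment> \<open>an even number of vectors larger than the rank\<close>
    define k where "k = (if even (r + 1) then r + 1 else r + 2)"
    have k: "even k" "r < k" "k \<le> n" using m by (auto simp: k_def n_def)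
    define M where "M = mat k k (\<lambda>(i, j). (if i = j then A else 0) + s i j)"
    have M: "M \<in> carrier_mat k k" by (simp add: M_def)
    have "odd (s i j)" if "i \<noteq> j" for i j using soff[OF that] by auto
    then have "det M \<noteq> 0"
      using ev by (intro det_ne_0_even_diag_odd_off_diag[OF M k(1)]) (auto simp: M_def s_def)
    \<comment> \<open>The relation of column \<open>r\<close> involves only the first \<open>r + 1\<close> vectors.\<close>
    define w where "w = Matrix.vec k (\<lambda>j. U $$ (j, r))"
    have rn: "r < n" using k by simp
    have AA: "real_of_int (if i = j then A else 0) = (if i = j then a else 0)" for i j :: nat
      by (simp add: A)
    have "map_mat real_of_int M *\<^sub>v w = 0\<^sub>v k"
    proof (rule eq_vecI)
      fix i assume "i < dim_vec (0\<^sub>v k :: real Matrix.vec)"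
      then have i: "i < k" by simp
      have "vec_index (map_mat real_of_int M *\<^sub>v w) i = (\<Sum>j<k. ((if i = j then a else 0) + real_of_int (s i j)) * U $$ (j, r))"
        using i M by (simp add: scalar_prod_def w_def atLeast0LessThan M_def AA)
      also have "\<dots> = (\<Sum>j<n. ((if i = j then a else 0) + real_of_int (s i j)) * U $$ (j, r))"
        using k rn by (intro sum.mono_neutral_left) (auto simp: U_def)
      also have "\<dots> = (\<Sum>j<n. (if j = i then a * U $$ (i, r) else 0) + real_of_int (s i j) * U $$ (j, r))"
        by (intro sum.cong refl) (auto simp: algebra_simps)
      also have "\<dots> = 0" using Ucol[of i r] i k rn by (simp add: sum.distrib)
      finally show "vec_index (map_mat real_of_int M *\<^sub>v w) i = vec_index (0\<^sub>v k) i" using i by simp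
    qed (use M in auto)
    moreover have "w \<noteq> 0\<^sub>v k"
    proof
      assume "w = 0\<^sub>v k"
      then have "vec_index w r = 0" using k(2) by simp
      then show False using k rn by (simp add: w_def U_def)
    qed
    moreover have "w \<in> carrier_vec k" by (simp add: w_def)
    ultimately have "det (map_mat real_of_int M) = 0"
      using det_0_iff_vec_prod_zero[of "map_mat real_of_int M" k] M by auto
    then show False using \<open>det M \<noteq> 0\<close> by simp
  qed
  have "1 < A" "A < 5" using a(1) a5 A by simp_all
  then have "A = 2 \<or> A = 3 \<or> A = 4" by auto
  then have "A = 3" using \<open>odd A\<close> by auto
  then have "\<alpha> = 1/3" using a(2) A by simp
  then show ?thesis using ip[OF xy] by auto
qed

lemma equiangular_card_less:
  fixes X :: "'a::euclidean_space set"
  assumes eq: "equiangular X" and r: "dim X = r" "8 \<le> r"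
    and m: "2 \<le> m" "odd m \<and> r = m + 1 \<or> r < m" "r < 2 * m" "r * (r + m - 1) < 25 * m"
    and n: "2 * (r - 1) < r + m"
  shows "card X < r + m"
proof (rule ccontr)
  assume "\<not> card X < r + m"
  then have big: "r + m \<le> card X" by simp
  have "finite X" "\<And>x. x \<in> X \<Longrightarrow> x \<bullet> x = 1" using eq by (auto simp: equiangular_def norm_eq_1)
  then have "card X \<le> 2 * (dim X - 1)"
    using equiangular_angle_eq_third[OF eq r(1) big m] r by (intro equiangular_third_card_le) auto
  then show False using big n r(1) by simp
qed

section \<open>Extremal configurations\<close>

lemma equiangular_cardsI:
  fixes f :: "'i \<Rightarrow> 'b::euclidean_space"
  assumes fin: "finite I" and \<alpha>: "0 \<le> \<alpha>" "\<alpha> < 1"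
    and un: "\<And>i. i \<in> I \<Longrightarrow> f i \<bullet> f i = 1"
    and ip: "\<And>i j. i \<in> I \<Longrightarrow> j \<in> I \<Longrightarrow> i \<noteq> j \<Longrightarrow> \<bar>f i \<bullet> f j\<bar> = \<alpha>"
  shows "card I \<in> equiangular_cards TYPE('b) (dim (f ` I))"
proof -
  have inj: "inj_on f I"
  proof (rule inj_onI, rule ccontr)
    fix i j assume ij: "i \<in> I" "j \<in> I" "f i = f j" "i \<noteq> j"
    then have "\<bar>f i \<bullet> f i\<bar> = \<alpha>" using ip[of i j] by metis
    then show False using un[OF ij(1)] \<alpha> by simp
  qed
  have "equiangular (f ` I)"
    unfolding equiangular_def
  proof (intro conjI exI[of _ \<alpha>] ballI impI)
    fix x assume "x \<in> f ` I"
    then show "norm x = 1" using un by (auto simp: norm_eq_1)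
  next
    fix x y assume "x \<in> f ` I" "y \<in> f ` I" "x \<noteq> y"
    then obtain i j where "i \<in> I" "j \<in> I" "i \<noteq> j" "x = f i" "y = f j" by auto
    then have "\<bar>x \<bullet> y\<bar> = \<alpha>" using ip by simp
    then show "x \<bullet> y \<in> {-\<alpha>, \<alpha>}" by auto
  qed (use fin \<alpha> in auto)
  moreover have "card (f ` I) = card I" using inj by (rule card_image)
  ultimately show ?thesis unfolding equiangular_cards_def by force
qed

text \<open>
  With an orthonormal basis \<open>b\<close> and up to the factor \<open>1/\<surd>3\<close>, the four vectors
  \<open>b\<^sub>0 + b\<^sub>1 + b\<^sub>2\<close>, \<open>b\<^sub>0 - b\<^sub>1 - b\<^sub>2\<close>, \<open>b\<^sub>1 - b\<^sub>0 - b\<^sub>2\<close>, \<open>b\<^sub>2 - b\<^sub>0 - b\<^sub>1\<close> of a regular tetrahedron are joined by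
  one pillar, which consists of \<open>b\<^sub>0 + \<surd>2 b\<^sub>i\<close> and \<open>b\<^sub>0 - \<surd>2 b\<^sub>i\<close> for \<open>i \<ge> 3\<close>.
\<close>

lemma single_pillar_construction:
  assumes r: "r \<ge> 3" "r \<le> DIM('a::euclidean_space)"
  shows "2 * (r - 1) \<in> equiangular_cards TYPE('a) r"
proof -
  note One_nat_def [simp del]
  obtain b :: "nat \<Rightarrow> 'a" where b: "bij_betw b {..<DIM('a)} Basis"
    using ex_bij_betw_nat_finite[of "Basis :: 'a set"] by (auto simp: atLeast0LessThan)
  have bb: "b i \<bullet> b j = (if i = j then 1 else 0)" if "i < r" "j < r" for i j
  proof -
    have "b i \<in> Basis" "b j \<in> Basis" using that r b by (auto simp: bij_betw_def)
    moreover have "b i = b j \<longleftrightarrow> i = j"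
      using that r bij_betw_imp_inj_on[OF b] by (auto simp: inj_on_eq_iff)
    ultimately show ?thesis by (simp add: inner_Basis)
  qed
  obtain k where k: "r = 3 + k" using r by (metis le_Suc_ex)
  define p where "p i = (if i = 0 then b 0 + b 1 + b 2 else if i = 1 then b 0 - b 1 - b 2
    else if i = 2 then b 1 - b 0 - b 2 else b 2 - b 0 - b 1)" for i :: nat
  define q where "q it = b 0 + (if snd it then sqrt 2 else - sqrt 2) *\<^sub>R b (3 + fst it)" for it :: "nat \<times> bool"
  define g where "g = case_sum p q"
  define f where "f x = (1 / sqrt 3) *\<^sub>R g x" for x
  define I where "I = {..<4::nat} <+> ({..<k} \<times> (UNIV :: bool set))"
  have cI: "card I = 2 * (r - 1)" by (simp add: I_def card_Plus k)
  have fI: "finite I" by (simp add: I_def)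
  have less4: "i < 4 \<longleftrightarrow> i = 0 \<or> i = 1 \<or> i = 2 \<or> i = 3" for i :: nat by auto
  have B: "b 0 \<bullet> b 0 = 1" "b 1 \<bullet> b 1 = 1" "b 2 \<bullet> b 2 = 1" "b 0 \<bullet> b 1 = 0" "b 0 \<bullet> b 2 = 0" "b 1 \<bullet> b 2 = 0"
    "b 1 \<bullet> b 0 = 0" "b 2 \<bullet> b 0 = 0" "b 2 \<bullet> b 1 = 0" using k by (simp_all add: bb)
  have B3: "b i \<bullet> b (3 + j) = 0" "b (3 + j) \<bullet> b i = 0" if "i < 3" "j < k" for i j
    using that k by (simp_all add: bb)
  have B4: "b (3 + i) \<bullet> b (3 + j) = (if i = j then 1 else 0)" if "i < k" "j < k" for i j
    using that k by (simp add: bb)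
  have pp: "p i \<bullet> p j = (if i = j then 3 else -1)" if "i < 4" "j < 4" for i j
    using that unfolding less4 by (elim disjE; simp add: p_def inner_add_left inner_add_right inner_diff_left inner_diff_right B)
  have pq: "\<bar>p i \<bullet> q jt\<bar> = 1" "\<bar>q jt \<bullet> p i\<bar> = 1" if "i < 4" "fst jt < k" for i jt
  proof -
    have *: "p i \<bullet> b (3 + fst jt) = 0" using that(2)
      by (simp add: p_def inner_add_left inner_diff_left B3(1)[of 0] B3(1)[of 1] B3(1)[of 2])
    have "\<bar>p i \<bullet> b 0\<bar> = 1" using that(1) unfolding less4
      by (elim disjE; simp add: p_def inner_add_left inner_diff_left B)
    then show "\<bar>p i \<bullet> q jt\<bar> = 1" unfolding q_def inner_add_right inner_scaleR_right * by simp
    then show "\<bar>q jt \<bullet> p i\<bar> = 1" by (simp only: inner_commute)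
  qed
  have qq: "q it \<bullet> q jt = (if it = jt then 3 else if fst it = fst jt then -1 else 1)"
    if "fst it < k" "fst jt < k" for it jt
  proof -
    have "q it \<bullet> q jt = 1 + (if snd it then sqrt 2 else - sqrt 2) * (if snd jt then sqrt 2 else - sqrt 2) *
      (b (3 + fst it) \<bullet> b (3 + fst jt))"
      unfolding q_def inner_add_left inner_add_right inner_scaleR_left inner_scaleR_right
      using that by (simp add: B B3(1)[of 0] B3(2)[of 0] del: One_nat_def)
    then show ?thesis unfolding B4[OF that] by (cases it; cases jt) auto
  qed
  have ff: "f x \<bullet> f y = (1/3) * (g x \<bullet> g y)" for x y
  proof -
    have "(1 / sqrt 3) * (1 / sqrt 3) = (1/3::real)" by simp
    then show ?thesis by (simp only: f_def inner_scaleR_left inner_scaleR_right mult.assoc[symmetric])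
  qed
  have "card I \<in> equiangular_cards TYPE('a) (dim (f ` I))"
  proof (rule equiangular_cardsI[OF fI, of "1/3"])
    fix x assume "x \<in> I" then show "f x \<bullet> f x = 1"
      by (auto simp: I_def ff g_def pp qq)
  next
    fix x y assume xy: "x \<in> I" "y \<in> I" "x \<noteq> y"
    have "\<bar>g x \<bullet> g y\<bar> = 1"
      using xy by (auto simp: I_def g_def pp pq qq split: if_splits)
    then show "\<bar>f x \<bullet> f y\<bar> = 1/3" by (simp add: ff abs_mult)
  qed auto
  moreover have "dim (f ` I) = r"
  proof (rule antisym)
    let ?B = "b ` {..<r}"
    have "b ` {..<r} \<subseteq> Basis" using b r by (auto simp: bij_betw_def)
    then have "independent ?B" using independent_Basis independent_mono by blast
    moreover have "card ?B = r"
      using bij_betw_imp_inj_on[OF b] r by (subst card_image) (auto intro: inj_on_subset)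
    ultimately have dB: "dim ?B = r" by (simp add: dim_eq_card_independent)
    have bs: "b i \<in> span ?B" if "i < r" for i using that by (simp add: span_base)
    have "f x \<in> span ?B" if "x \<in> I" for x
    proof -
      have "b 0 \<in> span ?B" "b 1 \<in> span ?B" "b 2 \<in> span ?B" using bs k by simp_all
      then have "p i \<in> span ?B" for i by (simp add: p_def span_add span_diff)
      moreover have "q it \<in> span ?B" if "fst it < k" for it
        unfolding q_def using that bs k by (intro span_add span_scale) auto
      ultimately have "g x \<in> span ?B" using that by (auto simp: I_def g_def)
      then show ?thesis by (simp add: f_def span_scale)
    qed
    then have "f ` I \<subseteq> span ?B" by blast
    then show "dim (f ` I) \<le> r" using dim_subset dB by (metis dim_span)
    have fs: "g x \<in> span (f ` I)" if "x \<in> I" for x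
    proof -
      have "g x = sqrt 3 *\<^sub>R f x" by (simp add: f_def)
      then show ?thesis using that by (simp add: span_base span_scale)
    qed
    have ps: "p i \<in> span (f ` I)" if "i < 4" for i
    proof -
      have "Inl i \<in> I" using that by (auto simp: I_def)
      from fs[OF this] show ?thesis by (simp add: g_def)
    qed
    have qs: "q (i, t) \<in> span (f ` I)" if "i < k" for i t
    proof -
      have "Inr (i, t) \<in> I" using that by (auto simp: I_def)
      from fs[OF this] show ?thesis by (simp add: g_def)
    qed
    have b3: "b i \<in> span (f ` I)" if i: "i < 3" for i
    proof -
      have "i = 0 \<or> i = 1 \<or> i = 2" using i by auto
      then have "p 0 + p (i + 1) = 2 *\<^sub>R b i" 
        by (elim disjE; simp add: p_def scaleR_2)
      moreover have "p 0 + p (i + 1) \<in> span (f ` I)" using i by (intro span_add ps) auto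
      ultimately have "(1/2) *\<^sub>R (2 *\<^sub>R b i) \<in> span (f ` I)" by (simp only: span_scale)
      then show ?thesis by simp
    qed
    have "b i \<in> span (f ` I)" if i: "i < r" for i
    proof (cases "i < 3")
      case False
      then obtain j where j: "i = 3 + j" "j < k" using i k by (metis le_Suc_ex nat_add_left_cancel_less not_less)
      have "q (j, True) - b 0 \<in> span (f ` I)" using qs[OF j(2)] b3[of 0] by (intro span_diff) auto
      then have "sqrt 2 *\<^sub>R b i \<in> span (f ` I)" by (simp add: q_def j)
      then have "(1 / sqrt 2) *\<^sub>R (sqrt 2 *\<^sub>R b i) \<in> span (f ` I)" by (rule span_scale)
      then show ?thesis by simp
    qed (rule b3)
    then have "?B \<subseteq> span (f ` I)" by blast
    then show "r \<le> dim (f ` I)" using dim_subset dB by (metis dim_span)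
  qed
  ultimately show ?thesis using cI by simp
qed

text \<open>
  The quadratic character modulo \<open>17\<close> on the residues \<open>0, \<dots>, 16\<close>.
\<close>

definition paley_char :: "nat \<Rightarrow> int" where
  "paley_char d = (if d = 0 then 0 else if d \<in> {1, 2, 4, 8, 9, 13, 15, 16} then 1 else -1)"

text \<open>
  The Paley conference matrix of order \<open>18\<close>: index \<open>0\<close> is the point at infinity, and the indices
  \<open>1, \<dots>, 17\<close> are the residues modulo \<open>17\<close>. Adding \<open>17\<close> keeps the subtraction from being truncated.
\<close>

definition paley_conf :: "nat \<Rightarrow> nat \<Rightarrow> int" where
  "paley_conf i j = (if i = j then 0 else if i = 0 \<or> j = 0 then 1 else paley_char ((17 + i - j) mod 17))"

lemma paley_conf_table:
  "list_all (\<lambda>i. list_all (\<lambda>k. paley_conf i k = paley_conf k i \<and>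
     \<bar>paley_conf i k\<bar> = (if i = k then 0 else 1) \<and>
     sum_list (map (\<lambda>j. paley_conf i j * paley_conf k j) [0..<18]) = (if i = k then 17 else 0))
     [0..<18]) [0..<18]"
  by code_simp

lemma paley_conf_facts:
  assumes "i < 18" "k < 18"
  shows "paley_conf i k = paley_conf k i" "\<bar>paley_conf i k\<bar> = (if i = k then 0 else 1)"
    "(\<Sum>j<18. paley_conf i j * paley_conf k j) = (if i = k then 17 else 0)"
proof -
  have "\<forall>i\<in>{..<18}. \<forall>k\<in>{..<18}. paley_conf i k = paley_conf k i \<and>
     \<bar>paley_conf i k\<bar> = (if i = k then 0 else 1) \<and>
     (\<Sum>j<18. paley_conf i j * paley_conf k j) = (if i = k then 17 else 0)"
    using paley_conf_table
    by (simp only: list_all_iff interv_sum_list_conv_sum_set_nat atLeast0LessThan set_upt)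
  moreover have "i \<in> {..<18}" "k \<in> {..<18}" using assms by simp_all
  ultimately show "paley_conf i k = paley_conf k i" "\<bar>paley_conf i k\<bar> = (if i = k then 0 else 1)"
    "(\<Sum>j<18. paley_conf i j * paley_conf k j) = (if i = k then 17 else 0)" by blast+
qed

text \<open>
  As \<open>S\<^sup>2 = 17 I\<close>, the matrix \<open>\<surd>17 I + S\<close> has square \<open>2 \<surd>17\<close> times itself, so its rows are
  equiangular with angle \<open>1/\<surd>17\<close>. The rows of \<open>\<surd>17 I - S\<close> are so, too, and are orthogonal to the
  former. The relative bound shows that both families have rank at least \<open>9\<close>, and together they fit
  into dimension \<open>18\<close>.
\<close>

lemma conference_construction: "18 \<in> equiangular_cards TYPE(real^18) 9"
proof -
  obtain b :: "nat \<Rightarrow> real^18" where b: "bij_betw b {..<18} Basis"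
    using ex_bij_betw_nat_finite[of "Basis :: (real^18) set"] by (auto simp: atLeast0LessThan)
  have bb: "b i \<bullet> b j = (if i = j then 1 else 0)" if "i < 18" "j < 18" for i j
  proof -
    have "b i \<in> Basis" "b j \<in> Basis" using that b by (auto simp: bij_betw_def)
    moreover have "b i = b j \<longleftrightarrow> i = j"
      using that bij_betw_imp_inj_on[OF b] by (auto simp: inj_on_eq_iff)
    ultimately show ?thesis by (simp add: inner_Basis)
  qed
  define S where "S i j = real_of_int (paley_conf i j)" for i j
  have S: "S i k = S k i" "\<bar>S i k\<bar> = (if i = k then 0 else 1)"
    "(\<Sum>j<18. S i j * S k j) = (if i = k then 17 else 0)" if "i < 18" "k < 18" for i k
  proof -
    show "S i k = S k i" using paley_conf_facts(1)[OF that] by (simp add: S_def)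
    have "\<bar>S i k\<bar> = real_of_int \<bar>paley_conf i k\<bar>" by (simp add: S_def)
    then show "\<bar>S i k\<bar> = (if i = k then 0 else 1)" using paley_conf_facts(2)[OF that] by simp
    have "(\<Sum>j<18. S i j * S k j) = real_of_int (\<Sum>j<18. paley_conf i j * paley_conf k j)"
      by (simp add: S_def)
    then show "(\<Sum>j<18. S i j * S k j) = (if i = k then 17 else 0)"
      using paley_conf_facts(3)[OF that] by simp
  qed
  define N where "N s i j = (if i = j then sqrt 17 else 0) + s * S i j" for s i j
  define f where "f s i = (1 / sqrt 34) *\<^sub>R (\<Sum>j<18. N s i j *\<^sub>R b j)" for s i
  have ff: "f s i \<bullet> f t k = (1/34) * ((if i = k then 17 else 0) + sqrt 17 * (s + t) * S i k + s * t * (if i = k then 17 else 0))"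
    if ik: "i < 18" "k < 18" for s t i k
  proof -
    have "(\<Sum>j<18. N s i j *\<^sub>R b j) \<bullet> (\<Sum>l<18. N t k l *\<^sub>R b l) =
      (\<Sum>j<18. \<Sum>l<18. if l = j then N s i j * N t k j else 0)"
      unfolding inner_sum_left inner_scaleR_left inner_sum_right inner_scaleR_right sum_distrib_left
      by (intro sum.cong refl) (auto simp: bb)
    also have "\<dots> = (\<Sum>j<18. N s i j * N t k j)" by simp
    also have "\<dots> = (\<Sum>j<18. (if i = j then (if i = k then 17 else 0) else 0) + (if i = j then sqrt 17 * t * S k i else 0)
       + (if k = j then sqrt 17 * s * S i k else 0) + s * t * (S i j * S k j))"
      by (intro sum.cong refl) (auto simp: N_def algebra_simps)
    also have "\<dots> = (if i = k then 17 else 0) + sqrt 17 * t * S k i + sqrt 17 * s * S i k + s * t * (\<Sum>j<18. S i j * S k j)"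
      using ik by (simp add: sum.distrib sum_distrib_left)
    also have "\<dots> = (if i = k then 17 else 0) + sqrt 17 * (s + t) * S i k + s * t * (if i = k then 17 else 0)"
      unfolding S(3)[OF ik] S(1)[OF ik(2,1)] by (simp add: algebra_simps)
    finally have e: "(\<Sum>j<18. N s i j *\<^sub>R b j) \<bullet> (\<Sum>l<18. N t k l *\<^sub>R b l) = \<dots>" .
    have "(1 / sqrt 34) * (1 / sqrt 34) = (1/34::real)" by simp
    then show ?thesis unfolding f_def inner_scaleR_left inner_scaleR_right e by (simp only: mult.assoc[symmetric])
  qed
  let ?I = "{..<18::nat}"
  have un: "f s i \<bullet> f s i = 1" if "s * s = 1" "i < 18" for s i
    using ff[OF that(2,2), of s s] S(2)[OF that(2,2)] that(1) by simp
  have ip: "\<bar>f s i \<bullet> f s k\<bar> = 1 / sqrt 17" if "\<bar>s\<bar> = 1" "i < 18" "k < 18" "i \<noteq> k" for s i k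
  proof -
    have e: "f s i \<bullet> f s k = (1/34) * (sqrt 17 * (s + s) * S i k)"
      using ff[OF that(2,3), of s s] that(4) by simp
    have "\<bar>f s i \<bullet> f s k\<bar> = (1/34) * (sqrt 17 * \<bar>s + s\<bar> * \<bar>S i k\<bar>)"
      by (simp only: e abs_mult) simp
    also have "\<dots> = sqrt 17 / 17" using S(2)[OF that(2,3)] that by simp
    also have "\<dots> = 1 / sqrt 17" by (simp add: field_simps)
    finally show ?thesis .
  qed
  have card: "card ?I \<in> equiangular_cards TYPE(real^18) (dim (f s ` ?I))" if "\<bar>s\<bar> = 1" for s
  proof (rule equiangular_cardsI[of _ "1 / sqrt 17"])
    fix i assume "i \<in> ?I" then show "f s i \<bullet> f s i = 1"
      using un[of s i] that abs_mult_self_eq[of s] by simp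
  next
    fix i j assume "i \<in> ?I" "j \<in> ?I" "i \<noteq> j"
    then show "\<bar>f s i \<bullet> f s j\<bar> = 1 / sqrt 17" using ip[OF that] by simp
  qed auto
  have dim9: "9 \<le> dim (f s ` ?I)" if s: "\<bar>s\<bar> = 1" for s
  proof -
    have s2: "s * s = 1" using s abs_mult_self_eq[of s] by simp
    have inj: "inj_on (f s) ?I"
    proof (rule inj_onI, rule ccontr)
      fix i j assume ij: "i \<in> ?I" "j \<in> ?I" "f s i = f s j" "i \<noteq> j"
      then have "\<bar>f s i \<bullet> f s i\<bar> = 1 / sqrt 17" using ip[OF s, of i j] by simp
      then show False using un[OF s2, of i] ij by simp
    qed
    have "(\<Sum>x\<in>f s ` ?I. \<Sum>y\<in>f s ` ?I. (x \<bullet> y)\<^sup>2) = (\<Sum>i<18. \<Sum>k<18. (f s i \<bullet> f s k)\<^sup>2)"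
      by (simp add: sum.reindex[OF inj])
    also have "\<dots> = (\<Sum>i<18::nat. \<Sum>k<18::nat. (if k = i then 16/17 else 0) + 1/17)"
    proof (intro sum.cong refl)
      fix i k :: nat assume "i \<in> {..<18}" "k \<in> {..<18}"
      then have ik: "i < 18" "k < 18" by auto
      show "(f s i \<bullet> f s k)\<^sup>2 = (if k = i then 16/17 else 0) + 1/17"
      proof (cases "k = i")
        case False
        then have "(\<bar>f s i \<bullet> f s k\<bar>)\<^sup>2 = 1/17" using ip[OF s ik] by (simp add: power_divide)
        then show ?thesis using False by simp
      qed (use un[OF s2 ik(1)] in simp)
    qed
    also have "\<dots> = 36" by (simp add: sum.distrib)
    finally have sm: "(\<Sum>x\<in>f s ` ?I. \<Sum>y\<in>f s ` ?I. (x \<bullet> y)\<^sup>2) = 36" .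
    have "(real (card (f s ` ?I)))\<^sup>2 \<le> real (dim (f s ` ?I)) * 36"
      unfolding sm[symmetric] using un[OF s2] by (intro card_power2_le_dim_sum_inner) (auto simp: norm_eq_1)
    then show ?thesis using card_image[OF inj] by simp
  qed
  have "dim (f 1 ` ?I \<union> f (-1) ` ?I) = dim (f 1 ` ?I) + dim (f (-1) ` ?I)"
    by (rule dim_orthogonal_sum) (auto simp: ff)
  moreover have "dim (f 1 ` ?I \<union> f (-1) ` ?I) \<le> 18"
    using dim_subset_UNIV[of "f 1 ` ?I \<union> f (-1) ` ?I"] by simp
  ultimately have "dim (f 1 ` ?I) = 9" using dim9[of 1] dim9[of "-1"] by simp
  then show ?thesis using card[of 1] by simp
qed

section \<open>The maximal cardinalities\<close>

lemma M_star_eqI: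
  assumes "k \<in> equiangular_cards TYPE('a::euclidean_space) r"
    and "\<And>X :: 'a set. equiangular X \<Longrightarrow> dim X = r \<Longrightarrow> card X \<le> k"
  shows "M_star TYPE('a) r = k"
  unfolding M_star_def
  using assms by (intro Max_eqI finite_equiangular_cards) (auto simp: equiangular_cards_def)

theorem theorem5p5:
  shows "(8 \<le> DIM('a::euclidean_space) \<longrightarrow> M_star TYPE('a) 8 = 14) \<and>
         (9 \<le> DIM('a) \<longrightarrow> M_star TYPE('a) 9 = 18) \<and>
         (10 \<le> DIM('a) \<longrightarrow> M_star TYPE('a) 10 = 18)"
proof (intro conjI impI)
  assume d: "8 \<le> DIM('a)"
  show "M_star TYPE('a) 8 = 14"
  proof (rule M_star_eqI)
    show "14 \<in> equiangular_cards TYPE('a) 8" using single_pillar_construction[of 8] d by simp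
    show "card X \<le> 14" if "equiangular X" "dim X = 8" for X :: "'a set"
      using equiangular_card_less[OF that, of 7] by simp
  qed
next
  assume d: "9 \<le> DIM('a)"
  show "M_star TYPE('a) 9 = 18"
  proof (rule M_star_eqI)
    show "18 \<in> equiangular_cards TYPE('a) 9"
      using conference_construction equiangular_cards_ambient_subset[OF d] by blast
    show "card X \<le> 18" if "equiangular X" "dim X = 9" for X :: "'a set"
      using equiangular_card_less[OF that, of 10] by simp
  qed
next
  assume d: "10 \<le> DIM('a)"
  show "M_star TYPE('a) 10 = 18"
  proof (rule M_star_eqI)
    show "18 \<in> equiangular_cards TYPE('a) 10" using single_pillar_construction[of 10] d by simp
    show "card X \<le> 18" if "equiangular X" "dim X = 10" for X :: "'a set"
      using equiangular_card_less[OF that, of 9] by simp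
  qed
qed

end
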